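(* Let $f\in L^2(\mathcal X,\mu)$ with $\mathbb V_\mu[f]>0$ satisfy $|f(x)|\le L$ for all $x\in\mathcal X$. Suppose the design points $x_1,\dots,x_n$ are sampled i.i.d. from $\mu$, and let $\hat f^P$ be the projection-method approximation of $f$ with truncation set $\mathcal L_N$, $|\mathcal L_N|=N$. Put $$\mathcal R_p^2=\frac{1}{\mathbb V_\mu[f]}\|e_N\|_\mu^2+\frac{L^2+\sigma^2}{\mathbb V_\mu[f]}\cdot\frac Nn,\qquad \mathcal R_p\ge0.$$ Let $(S_U,\hat S^P_U)$ denote either the Sobol' indices of $f$ and $\hat f^P$ for $U$, or (for all $U$ simultaneously) the total-effect indices of $f$ and $\hat f^P$ for $U$. Then in both cases $$\max_{U\subseteq\{1,\dots,d\}}\mathbb E\big(S_U-\hat S_U^P\big)^2\le\mathcal R_p^2,$$ and for every $U\subseteq\{1,\dots,d\}$ $$\mathbb E\big|S_U-\hat S_U^P\big|\le\mathcal R_p\,\big(\mathcal R_p+2\sqrt{S_U}\big).$$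
   Context: $\mathcal X=\mathcal X_1\times\dots\times\mathcal X_d$ with $\mathcal X_i\subseteq\mathbb R$, and $\mu=\mu_1\otimes\dots\otimes\mu_d$ is a product of probability measures $\mu_i$ on $\mathcal X_i$. $\langle g,h\rangle_\mu=\int gh\,d\mu$, $\|g\|_\mu$ is the $L^2(\mathcal X,\mu)$ norm; $\mathbb E_\mu,\mathbb V_\mu$ are mean and variance under $\mu$. Every $f\in L^2(\mathcal X,\mu)$ has a unique Sobol-Hoeffding decomposition $f(x)=\sum_{U\subseteq\{1,\dots,d\}}f_U(x_U)$, where $f_U$ depends only on $x_U=(x_i)_{i\in U}$, $f_\emptyset=\mathbb E_\mu[f]$, and $\int_{\mathcal X_i}f_U(x_U)\,d\mu_i(x_i)=0$ for every $i\in U$. When $\mathbb V_\mu[f]>0$, the Sobol' index of $U$ is $S_U=\mathbb V_\mu[f_U]/\mathbb V_\mu[f]$, and the total-effect index is $T_U=\sum_{V:\,V\cap U\ne\emptyset}S_V$ ($S_\emptyset=T_\emptyset=0$). If an approximation $\hat f$ has $\mathbb V_\mu[\hat f]=0$, its indices are by convention all set equal to $2^{-d}$. Regressors: for each $i$, $\{\psi^{(i)}_\alpha\}_{\alpha\in\mathbb N}$ ($\mathbb N=\{0,1,2,\dots\}$) is a $\mu_i$-orthonormal family with $\psi^{(i)}_0=1$, and $\Psi_\alpha(x)=\prod_{i=1}^d\psi^{(i)}_{\alpha_i}(x_i)$ for multi-indices $\alpha\in\mathbb N^d$. Fixed nested sets $\{\mathbf 0\}=\mathcal L_1\subset\mathcal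 L_2\subset\dots\subset\mathbb N^d$ with $|\mathcal L_N|=N$ are given; $V_N=\mathrm{span}\{\Psi_\alpha:\alpha\in\mathcal L_N\}$; $f_N$ is the $\mu$-orthogonal projection of $f$ onto $V_N$ and $e_N=f-f_N$. Training sample: $y_i=f(x_i)+\eta_i$, $i=1,\dots,n$, with $\eta_i$ i.i.d., $\mathbb E\eta_i=0$, $\mathbb V\eta_i=\sigma^2<\infty$ ($\sigma^2=0$ allowed), independent of the design. Projection (quasi-regression) method: $\hat f^P=\sum_{\alpha\in\mathcal L_N}\hat c_\alpha\Psi_\alpha$ with $\hat c_\alpha=\frac1n\sum_{i=1}^n y_i\Psi_\alpha(x_i)$. $\mathbb E$ without subscript is expectation over design and noise. *)

theory Defs
  imports "HOL-Probability.Probability"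
begin

abbreviation prod_measure :: "nat \<Rightarrow> (nat \<Rightarrow> real measure) \<Rightarrow> (nat \<Rightarrow> real) measure"
  where "prod_measure d M \<equiv> PiM {1..d} M"

definition mean :: "'a measure \<Rightarrow> ('a \<Rightarrow> real) \<Rightarrow> real"
  where "mean P g = (\<integral>x. g x \<partial>P)"

definition var :: "'a measure \<Rightarrow> ('a \<Rightarrow> real) \<Rightarrow> real"
  where "var P g = (\<integral>x. (g x - mean P g)\<^sup>2 \<partial>P)"

definition in_L2 :: "'a measure \<Rightarrow> ('a \<Rightarrow> real) \<Rightarrow> bool"
  where "in_L2 P g \<longleftrightarrow> g \<in> borel_measurable P \<and> integrable P (\<lambda>x. (g x)\<^sup>2)"

definition inner_L2 :: "'a measure \<Rightarrow> ('a \<Rightarrow> real) \<Rightarrow> ('a \<Rightarrow> real) \<Rightarrow> real"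
  where "inner_L2 P g h = (\<integral>x. g x * h x \<partial>P)"

definition norm_L2 :: "'a measure \<Rightarrow> ('a \<Rightarrow> real) \<Rightarrow> real"
  where "norm_L2 P g = sqrt (inner_L2 P g g)"

text \<open>The library's \<open>indep_var\<close> needs both variables to have the same value type; this is
  the same notion for different value types.\<close>

definition independent_rvs ::
  "'w measure \<Rightarrow> 'a measure \<Rightarrow> ('w \<Rightarrow> 'a) \<Rightarrow> 'b measure \<Rightarrow> ('w \<Rightarrow> 'b) \<Rightarrow> bool"
  where "independent_rvs P A X B Y \<longleftrightarrow>
    X \<in> measurable P A \<and> Y \<in> measurable P B \<and>
    prob_space.indep_set P {X -` S \<inter> space P | S. S \<in> sets A} {Y -` S \<inter> space P | S. S \<in> sets B}"

text \<open>
  A Sobol-Hoeffding decomposition of \<open>f\<close>.  The component \<open>F U\<close> is a function of the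
  subvector \<open>restrict x U\<close> only, so it lives on \<open>PiM U M\<close>.  As usual in \<open>L\<^sup>2\<close>, pointwise
  identities are required almost everywhere; components are unique up to null sets.
\<close>

definition sobol_decomposition ::
  "nat \<Rightarrow> (nat \<Rightarrow> real measure) \<Rightarrow> ((nat \<Rightarrow> real) \<Rightarrow> real)
     \<Rightarrow> (nat set \<Rightarrow> (nat \<Rightarrow> real) \<Rightarrow> real) \<Rightarrow> bool"
  where "sobol_decomposition d M f F \<longleftrightarrow>
    (\<forall>U\<subseteq>{1..d}. in_L2 (PiM U M) (F U)) \<and>
    (AE x in prod_measure d M. f x = (\<Sum>U\<in>Pow {1..d}. F U (restrict x U))) \<and>
    (\<forall>z\<in>space (PiM {} M). F {} z = mean (prod_measure d M) f) \<and>
    (\<forall>U\<subseteq>{1..d}. \<forall>i\<in>U. AE z in PiM (U - {i}) M. (\<integral>t. F U (z(i := t)) \<partial>M i) = 0)"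

text \<open>The choice of representative is immaterial, since only variances of components are used.\<close>

definition sobol_component ::
  "nat \<Rightarrow> (nat \<Rightarrow> real measure) \<Rightarrow> ((nat \<Rightarrow> real) \<Rightarrow> real) \<Rightarrow> nat set \<Rightarrow> (nat \<Rightarrow> real) \<Rightarrow> real"
  where "sobol_component d M f U =
    (\<lambda>x. (SOME F. sobol_decomposition d M f F) U (restrict x U))"

text \<open>For zero variance all indices (Sobol and total-effect) are set to \<open>2\<close> to the power \<open>-d\<close>.\<close>

definition sobol_index ::
  "nat \<Rightarrow> (nat \<Rightarrow> real measure) \<Rightarrow> ((nat \<Rightarrow> real) \<Rightarrow> real) \<Rightarrow> nat set \<Rightarrow> real"
  where "sobol_index d M f U =
    (if var (prod_measure d M) f = 0 then 1 / 2 ^ d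
     else var (prod_measure d M) (sobol_component d M f U) / var (prod_measure d M) f)"

definition total_effect_index ::
  "nat \<Rightarrow> (nat \<Rightarrow> real measure) \<Rightarrow> ((nat \<Rightarrow> real) \<Rightarrow> real) \<Rightarrow> nat set \<Rightarrow> real"
  where "total_effect_index d M f U =
    (if var (prod_measure d M) f = 0 then 1 / 2 ^ d
     else (\<Sum>W | W \<subseteq> {1..d} \<and> W \<inter> U \<noteq> {}. sobol_index d M f W))"

definition orthonormal_family :: "'a measure \<Rightarrow> (nat \<Rightarrow> 'a \<Rightarrow> real) \<Rightarrow> bool"
  where "orthonormal_family P \<psi> \<longleftrightarrow>
    (\<forall>k. in_L2 P (\<psi> k)) \<and> (\<forall>j k. inner_L2 P (\<psi> j) (\<psi> k) = (if j = k then 1 else 0))"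

text \<open>Multi-indices of length \<open>d\<close> are extensional functions on \<open>{1..d}\<close>, like the points of
  the product space.\<close>

abbreviation multi_indices :: "nat \<Rightarrow> (nat \<Rightarrow> nat) set"
  where "multi_indices d \<equiv> {1..d} \<rightarrow>\<^sub>E UNIV"

definition zero_index :: "nat \<Rightarrow> nat \<Rightarrow> nat"
  where "zero_index d = (\<lambda>i\<in>{1..d}. 0)"

definition tensor_regressor ::
  "nat \<Rightarrow> (nat \<Rightarrow> nat \<Rightarrow> real \<Rightarrow> real) \<Rightarrow> (nat \<Rightarrow> nat) \<Rightarrow> (nat \<Rightarrow> real) \<Rightarrow> real"
  where "tensor_regressor d \<psi> \<alpha> x = (\<Prod>i\<in>{1..d}. \<psi> i (\<alpha> i) (x i))"

text \<open>The linear span of the regressors indexed by the finite set \<open>A\<close>.\<close>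

definition regressor_span ::
  "nat \<Rightarrow> (nat \<Rightarrow> nat \<Rightarrow> real \<Rightarrow> real) \<Rightarrow> (nat \<Rightarrow> nat) set \<Rightarrow> ((nat \<Rightarrow> real) \<Rightarrow> real) set"
  where "regressor_span d \<psi> A =
    {g. \<exists>c. g = (\<lambda>x. \<Sum>\<alpha>\<in>A. c \<alpha> * tensor_regressor d \<psi> \<alpha> x)}"

definition is_orthogonal_projection ::
  "'a measure \<Rightarrow> ('a \<Rightarrow> real) set \<Rightarrow> ('a \<Rightarrow> real) \<Rightarrow> ('a \<Rightarrow> real) \<Rightarrow> bool"
  where "is_orthogonal_projection P V f g \<longleftrightarrow>
    g \<in> V \<and> (\<forall>h\<in>V. inner_L2 P (\<lambda>x. f x - g x) h = 0)"

definition projection_coeff ::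
  "nat \<Rightarrow> (nat \<Rightarrow> nat \<Rightarrow> real \<Rightarrow> real) \<Rightarrow> nat \<Rightarrow> (nat \<Rightarrow> (nat \<Rightarrow> real)) \<Rightarrow> (nat \<Rightarrow> real)
     \<Rightarrow> (nat \<Rightarrow> nat) \<Rightarrow> real"
  where "projection_coeff d \<psi> n xs ys \<alpha> =
    1 / real n * (\<Sum>i=1..n. ys i * tensor_regressor d \<psi> \<alpha> (xs i))"

definition projection_approx ::
  "nat \<Rightarrow> (nat \<Rightarrow> nat \<Rightarrow> real \<Rightarrow> real) \<Rightarrow> (nat \<Rightarrow> nat) set \<Rightarrow> nat
     \<Rightarrow> (nat \<Rightarrow> (nat \<Rightarrow> real)) \<Rightarrow> (nat \<Rightarrow> real) \<Rightarrow> (nat \<Rightarrow> real) \<Rightarrow> real"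
  where "projection_approx d \<psi> A n xs ys x =
    (\<Sum>\<alpha>\<in>A. projection_coeff d \<psi> n xs ys \<alpha> * tensor_regressor d \<psi> \<alpha> x)"

end

theory Submission
  imports Defs
begin

text \<open>
  Both kinds of index are the share \<open>\<parallel>a\<^sub>T\<parallel>\<^sup>2 / \<parallel>a\<parallel>\<^sup>2\<close> of the squared norm of a centred
  function \<open>a\<close> that lies in an orthogonal sum \<open>T\<close> of Sobol-Hoeffding components.  A share is
  \<open>sin\<^sup>2 \<theta>\<close> for the angle \<open>\<theta>\<close> between \<open>a\<close> and the orthogonal complement of \<open>T\<close>, and

  \<open>sin\<^sup>2 \<theta> - sin\<^sup>2 \<phi> = sin (\<theta> - \<phi>) sin (\<theta> + \<phi>)\<close>,
  \<open>\<bar>sin (\<theta> + \<phi>)\<bar> \<le> 2 sin \<theta> + \<bar>sin (\<theta> - \<phi>)\<bar>\<close>,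

  while \<open>\<bar>sin (\<theta> - \<phi>)\<bar>\<close> is at most the distance of the two functions relative to \<open>\<parallel>a\<parallel>\<close>.  So with
  \<open>e = \<parallel>f - g\<parallel>\<^sup>2 / Var f\<close> the share \<open>S\<close> of \<open>f\<close> and the share \<open>S'\<close> of \<open>g\<close> satisfy
  \<open>(S - S')\<^sup>2 \<le> e\<close> and \<open>\<bar>S - S'\<bar> \<le> e + 2 \<surd>S \<surd>e\<close> (\<open>share_diff_bounds\<close>,
  \<open>share_perturbation\<close>).  If \<open>g\<close> has variance zero, then \<open>e \<ge> 1\<close> and any value in the unit
  interval, in particular the conventional one, will do as \<open>S'\<close>.

  This needs decompositions to exist, to be orthogonal and to have components of unique variance.
  Orthogonality is Fubini's theorem (\<open>zero_mean_orthogonal\<close>); uniqueness follows from the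
  resulting Parseval identity.  For the bounded function \<open>f\<close> the components are the Moebius
  inverse of the conditional means (\<open>sobol_decomposition_bounded\<close>); for the approximation they
  are read off from the supports of the multi-indices
  (\<open>sobol_decomposition_expansion\<close>), which also makes its indices measurable functions of the
  empirical coefficients.

  It remains to bound the expectation of \<open>e\<close>.  By Pythagoras, \<open>\<parallel>f - fhat\<parallel>\<^sup>2\<close> is the projection error
  plus the squared errors of the \<open>N\<close> coefficients (\<open>expansion_dist_projection\<close>), each of
  which has mean at most \<open>(L\<^sup>2 + \<sigma>\<^sup>2) / n\<close> (\<open>empirical_coefficient_error\<close>).  Hence the mean of
  \<open>e\<close> is at most \<open>Rp\<^sup>2\<close>, and that of \<open>\<surd>e\<close> is at most \<open>Rp\<close> by the Cauchy-Schwarz inequality.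
\<close>

section \<open>Square-integrable functions\<close>

lemma in_L2_mult_integrable:
  assumes "in_L2 P g" "in_L2 P h"
  shows "integrable P (\<lambda>x. g x * h x)"
proof (rule Bochner_Integration.integrable_bound)
  show "integrable P (\<lambda>x. (g x)\<^sup>2 + (h x)\<^sup>2)" "(\<lambda>x. g x * h x) \<in> borel_measurable P"
    using assms by (auto simp: in_L2_def)
  have "\<bar>a * b\<bar> \<le> a\<^sup>2 + b\<^sup>2" for a b :: real
  proof -
    have "2 * (\<bar>a\<bar> * \<bar>b\<bar>) \<le> a\<^sup>2 + b\<^sup>2"
      using sum_squares_bound[of "\<bar>a\<bar>" "\<bar>b\<bar>"] by simp
    moreover have "0 \<le> a\<^sup>2 + b\<^sup>2" by simp
    ultimately show ?thesis unfolding abs_mult by linarith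
  qed
  then show "AE x in P. norm (g x * h x) \<le> norm ((g x)\<^sup>2 + (h x)\<^sup>2)"
    by (intro AE_I2) (simp add: abs_of_nonneg)
qed

lemma in_L2_cmult: "in_L2 P g \<Longrightarrow> in_L2 P (\<lambda>x. c * g x)"
  by (auto simp: in_L2_def power_mult_distrib)

lemma in_L2_add:
  assumes "in_L2 P g" "in_L2 P h"
  shows "in_L2 P (\<lambda>x. g x + h x)"
  using assms in_L2_mult_integrable[OF assms]
  by (auto simp: in_L2_def power2_sum mult.assoc)

lemma in_L2_diff: "in_L2 P g \<Longrightarrow> in_L2 P h \<Longrightarrow> in_L2 P (\<lambda>x. g x - h x)"
  using in_L2_add[of P g "\<lambda>x. - 1 * h x"] in_L2_cmult[of P h "-1"] by simp

lemma in_L2_sum: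
  assumes "\<And>i. i \<in> A \<Longrightarrow> in_L2 P (g i)"
  shows "in_L2 P (\<lambda>x. \<Sum>i\<in>A. g i x)"
  using assms
proof (induction A rule: infinite_finite_induct)
  case (insert a A)
  then show ?case by (auto intro!: in_L2_add)
qed (auto simp: in_L2_def)

lemma (in finite_measure) in_L2_bounded:
  assumes [measurable]: "g \<in> borel_measurable M" and "\<And>x. x \<in> space M \<Longrightarrow> \<bar>g x\<bar> \<le> B"
  shows "in_L2 M g"
  unfolding in_L2_def
proof
  show "integrable M (\<lambda>x. (g x)\<^sup>2)"
  proof (rule integrable_const_bound)
    show "AE x in M. norm ((g x)\<^sup>2) \<le> B\<^sup>2"
      using assms(2) power_mono[of "\<bar>g _\<bar>" B 2] by (intro AE_I2) auto
  qed simp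
qed fact

lemma (in finite_measure) in_L2_integrable: "in_L2 M g \<Longrightarrow> integrable M g"
  by (auto simp: in_L2_def intro: square_integrable_imp_integrable)

lemma inner_L2_commute: "inner_L2 P g h = inner_L2 P h g"
  by (simp add: inner_L2_def mult.commute)

lemma inner_L2_self_nonneg: "0 \<le> inner_L2 P g g"
  by (auto simp: inner_L2_def intro!: integral_nonneg_AE)

lemma norm_L2_power2: "(norm_L2 P g)\<^sup>2 = inner_L2 P g g"
  by (simp add: norm_L2_def inner_L2_self_nonneg)

lemma inner_L2_sum_left:
  assumes "\<And>i. i \<in> A \<Longrightarrow> in_L2 P (g i)" "in_L2 P h"
  shows "inner_L2 P (\<lambda>x. \<Sum>i\<in>A. g i x) h = (\<Sum>i\<in>A. inner_L2 P (g i) h)"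
  unfolding inner_L2_def sum_distrib_right
  by (rule Bochner_Integration.integral_sum) (use assms in_L2_mult_integrable in blast)

lemma inner_L2_sum_right:
  assumes "\<And>i. i \<in> A \<Longrightarrow> in_L2 P (g i)" "in_L2 P h"
  shows "inner_L2 P h (\<lambda>x. \<Sum>i\<in>A. g i x) = (\<Sum>i\<in>A. inner_L2 P h (g i))"
  using inner_L2_sum_left[OF assms] by (simp add: inner_L2_commute[of P h])

lemma inner_L2_cmult_left: "inner_L2 P (\<lambda>x. c * g x) h = c * inner_L2 P g h"
  by (simp add: inner_L2_def mult.assoc)

lemma inner_L2_cmult_right: "inner_L2 P h (\<lambda>x. c * g x) = c * inner_L2 P h g"
  by (simp add: inner_L2_def mult.left_commute)

lemma inner_L2_diff_left:
  assumes "in_L2 P g" "in_L2 P g'" "in_L2 P h"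
  shows "inner_L2 P (\<lambda>x. g x - g' x) h = inner_L2 P g h - inner_L2 P g' h"
  using in_L2_mult_integrable[OF assms(1,3)] in_L2_mult_integrable[OF assms(2,3)]
  by (simp add: inner_L2_def left_diff_distrib)

lemma inner_L2_diff_self:
  assumes "in_L2 P g" "in_L2 P h"
  shows "inner_L2 P (\<lambda>x. g x - h x) (\<lambda>x. g x - h x)
    = inner_L2 P g g - 2 * inner_L2 P g h + inner_L2 P h h"
proof -
  have "inner_L2 P (\<lambda>x. g x - h x) (\<lambda>x. g x - h x)
      = (\<integral>x. g x * g x - 2 * (g x * h x) + h x * h x \<partial>P)"
    unfolding inner_L2_def
    by (rule Bochner_Integration.integral_cong[OF refl]) (simp add: algebra_simps)
  also have "\<dots> = inner_L2 P g g - 2 * inner_L2 P g h + inner_L2 P h h"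
    using in_L2_mult_integrable[OF assms(1,1)] in_L2_mult_integrable[OF assms]
      in_L2_mult_integrable[OF assms(2,2)]
    by (simp add: inner_L2_def)
  finally show ?thesis .
qed

lemma inner_L2_Cauchy_Schwarz:
  assumes "in_L2 P g" "in_L2 P h"
  shows "inner_L2 P g h \<le> norm_L2 P g * norm_L2 P h"
proof -
  let ?a = "inner_L2 P g g" and ?b = "inner_L2 P g h" and ?c = "inner_L2 P h h"
  have quad: "0 \<le> ?a - 2 * (t * ?b) + t\<^sup>2 * ?c" for t
    using inner_L2_self_nonneg[of P "\<lambda>x. g x - t * h x"]
      inner_L2_diff_self[OF assms(1) in_L2_cmult[OF assms(2), of t]]
    by (simp add: inner_L2_cmult_left inner_L2_cmult_right power2_eq_square mult.assoc)
  have "?b\<^sup>2 \<le> ?a * ?c"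
  proof (cases "?c = 0")
    case True
    \<comment> \<open>A linear function of \<open>t\<close> that is bounded below is constant.\<close>
    have "?b = 0"
    proof (rule ccontr)
      assume "?b \<noteq> 0"
      then show False using quad[of "(?a + 1) / (2 * ?b)"] True by (simp add: field_simps)
    qed
    then show ?thesis by (simp add: True)
  next
    case False
    then have "?c > 0" using inner_L2_self_nonneg[of P h] by linarith
    then show ?thesis using quad[of "?b / ?c"] by (simp add: field_simps power2_eq_square)
  qed
  then have "sqrt (?b\<^sup>2) \<le> sqrt (?a * ?c)" by (rule real_sqrt_le_mono)
  then show ?thesis by (simp add: norm_L2_def real_sqrt_mult)
qed

lemma inner_L2_cong_AE:
  assumes "AE x in P. g x = g' x" "AE x in P. h x = h' x"
    and "g \<in> borel_measurable P" "g' \<in> borel_measurable P"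
    "h \<in> borel_measurable P" "h' \<in> borel_measurable P"
  shows "inner_L2 P g h = inner_L2 P g' h'"
  unfolding inner_L2_def using assms by (intro integral_cong_AE) auto

lemma norm_L2_diff_lower:
  assumes "in_L2 P g" "in_L2 P h"
  shows "(norm_L2 P g - norm_L2 P h)\<^sup>2 \<le> (norm_L2 P (\<lambda>x. g x - h x))\<^sup>2"
  using inner_L2_Cauchy_Schwarz[OF assms]
  by (simp add: power2_diff norm_L2_power2 inner_L2_diff_self[OF assms])

lemma norm_L2_eqI:
  assumes "in_L2 P g" "in_L2 P h" "norm_L2 P (\<lambda>x. g x - h x) = 0"
  shows "norm_L2 P g = norm_L2 P h"
  using norm_L2_diff_lower[OF assms(1,2)] assms(3) by simp

lemma (in prob_space) var_eq_inner_L2: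
  assumes "in_L2 M g"
  shows "var M g = inner_L2 M g g - (mean M g)\<^sup>2"
  using variance_eq[OF in_L2_integrable[OF assms]] assms
  by (simp add: var_def mean_def inner_L2_def in_L2_def power2_eq_square)

section \<open>Comparing the squared sines of two angles\<close>

text \<open>
  Let \<open>(p, q)\<close> and \<open>(r, s)\<close> be the norms of the two orthogonal parts of two vectors.  Since
  \<open>p\<^sup>2 (r\<^sup>2 + s\<^sup>2) - r\<^sup>2 (p\<^sup>2 + q\<^sup>2) = (p s - q r) (p s + q r)\<close>, the shares of the
  first part differ by \<open>sin (\<theta> - \<phi>) sin (\<theta> + \<phi>)\<close> for the angles \<open>\<theta>\<close>, \<open>\<phi>\<close> of the two pairs,
  and the distance of \<open>(p, q)\<close> from \<open>(r, s)\<close> is at least \<open>\<bar>sin (\<theta> - \<phi>)\<bar>\<close> times the length of \<open>(p, q)\<close>.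
\<close>

lemma share_diff_bounds:
  fixes p q r s e :: real
  assumes nonneg: "p \<ge> 0" "q \<ge> 0" "r \<ge> 0" "s \<ge> 0"
    and V: "p\<^sup>2 + q\<^sup>2 > 0" and W: "r\<^sup>2 + s\<^sup>2 > 0" and "e \<ge> 0"
    and dist: "(p - r)\<^sup>2 + (q - s)\<^sup>2 \<le> e * (p\<^sup>2 + q\<^sup>2)"
  defines "S \<equiv> p\<^sup>2 / (p\<^sup>2 + q\<^sup>2)" and "S' \<equiv> r\<^sup>2 / (r\<^sup>2 + s\<^sup>2)"
  shows "(S - S')\<^sup>2 \<le> e" and "\<bar>S - S'\<bar> \<le> e + 2 * sqrt S * sqrt e"
proof -
  define v w where "v = sqrt (p\<^sup>2 + q\<^sup>2)" and "w = sqrt (r\<^sup>2 + s\<^sup>2)"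
  define a b where "a = (p * s - q * r) / (v * w)" and "b = (p * s + q * r) / (v * w)"
  have v: "v > 0" "v\<^sup>2 = p\<^sup>2 + q\<^sup>2" and w: "w > 0" "w\<^sup>2 = r\<^sup>2 + s\<^sup>2"
    using V W by (auto simp: v_def w_def)
  have diff: "S - S' = a * b"
  proof -
    have "S - S' = (p\<^sup>2 * w\<^sup>2 - r\<^sup>2 * v\<^sup>2) / (v\<^sup>2 * w\<^sup>2)"
      unfolding S_def S'_def v(2)[symmetric] w(2)[symmetric] using v(1) w(1)
      by (simp add: diff_frac_eq)
    also have "p\<^sup>2 * w\<^sup>2 - r\<^sup>2 * v\<^sup>2 = (p * s - q * r) * (p * s + q * r)"
      unfolding v w by algebra
    finally show ?thesis by (simp add: a_def b_def power2_eq_square mult_ac)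
  qed
  have "(p * s - q * r)\<^sup>2 \<le> ((p - r)\<^sup>2 + (q - s)\<^sup>2) * w\<^sup>2"
  proof -
    have "((p - r)\<^sup>2 + (q - s)\<^sup>2) * w\<^sup>2 - (p * s - q * r)\<^sup>2 = (r * (p - r) + s * (q - s))\<^sup>2"
      unfolding w by algebra
    then show ?thesis by (metis diff_ge_0_iff_ge zero_le_power2)
  qed
  also have "\<dots> \<le> e * v\<^sup>2 * w\<^sup>2"
    using dist unfolding v(2) by (intro mult_right_mono) auto
  finally have "(p * s - q * r)\<^sup>2 \<le> e * (v * w)\<^sup>2"
    by (simp add: power_mult_distrib mult.assoc)
  then have a: "a\<^sup>2 \<le> e"
    unfolding a_def power_divide using v(1) w(1) by (subst pos_divide_le_eq) auto
  have "(p * s + q * r)\<^sup>2 \<le> v\<^sup>2 * w\<^sup>2"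
  proof -
    have "v\<^sup>2 * w\<^sup>2 - (p * s + q * r)\<^sup>2 = (p * r - q * s)\<^sup>2"
      unfolding v w by algebra
    then show ?thesis by (metis diff_ge_0_iff_ge zero_le_power2)
  qed
  then have "(p * s + q * r)\<^sup>2 \<le> 1 * (v * w)\<^sup>2" by (simp add: power_mult_distrib)
  then have b: "b\<^sup>2 \<le> 1"
    unfolding b_def power_divide using v(1) w(1) by (subst pos_divide_le_eq) auto
  have "(S - S')\<^sup>2 = a\<^sup>2 * b\<^sup>2" by (simp add: diff power_mult_distrib)
  also have "\<dots> \<le> a\<^sup>2 * 1" using b by (intro mult_left_mono) auto
  finally show "(S - S')\<^sup>2 \<le> e" using a by simp
  have "\<bar>a\<bar> = sqrt (a\<^sup>2)" by simp
  also have "\<dots> \<le> sqrt e" using a by (rule real_sqrt_le_mono)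
  finally have abs_a: "\<bar>a\<bar> \<le> sqrt e" .
  have "s \<le> w" unfolding w_def by (rule real_le_rsqrt) simp
  have sqrt_S: "sqrt S = p / v" using nonneg by (simp add: S_def v_def real_sqrt_divide)
  \<comment> \<open>The identity \<open>sin (\<theta> + \<phi>) = 2 sin \<theta> cos \<phi> - sin (\<theta> - \<phi>)\<close>.\<close>
  have "b = 2 * (p / v) * (s / w) - a"
    by (simp add: a_def b_def diff_divide_distrib add_divide_distrib)
  moreover have "2 * (p / v) * (s / w) \<le> 2 * (p / v) * 1"
    using v(1) w(1) nonneg \<open>s \<le> w\<close> by (intro mult_left_mono) auto
  moreover have "b \<ge> 0" using v(1) w(1) nonneg by (simp add: b_def)
  ultimately have abs_b: "\<bar>b\<bar> \<le> 2 * sqrt S + \<bar>a\<bar>"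
    unfolding sqrt_S by linarith
  have "\<bar>S - S'\<bar> = \<bar>a\<bar> * \<bar>b\<bar>" by (simp add: diff abs_mult)
  also have "\<dots> \<le> \<bar>a\<bar> * (2 * sqrt S + \<bar>a\<bar>)" using abs_b by (intro mult_left_mono) auto
  also have "\<dots> \<le> sqrt e * (2 * sqrt S + sqrt e)"
    using abs_a sqrt_S nonneg(1) v(1) \<open>e \<ge> 0\<close> by (intro mult_mono add_mono) auto
  also have "\<dots> = e + 2 * sqrt S * sqrt e"
    using \<open>e \<ge> 0\<close> by (simp add: algebra_simps)
  finally show "\<bar>S - S'\<bar> \<le> e + 2 * sqrt S * sqrt e" .
qed

section \<open>Sobol-Hoeffding decompositions\<close>

text \<open>The components of a decomposition as functions on the whole product space.\<close>

abbreviation lift :: "(nat set \<Rightarrow> (nat \<Rightarrow> real) \<Rightarrow> real) \<Rightarrow> nat set \<Rightarrow> (nat \<Rightarrow> real) \<Rightarrow> real"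
  where "lift F U \<equiv> \<lambda>x. F U (restrict x U)"

text \<open>The variance captured by the component \<open>U\<close>; the constant component carries none.\<close>

definition component_var ::
  "nat \<Rightarrow> (nat \<Rightarrow> real measure) \<Rightarrow> (nat set \<Rightarrow> (nat \<Rightarrow> real) \<Rightarrow> real) \<Rightarrow> nat set \<Rightarrow> real"
  where "component_var d M F U =
    (if U = {} then 0 else inner_L2 (prod_measure d M) (lift F U) (lift F U))"

lemma component_var_nonneg: "0 \<le> component_var d M F U"
  by (simp add: component_var_def inner_L2_self_nonneg)

lemma (in product_prob_space) prob_space_PiM_all: "prob_space (PiM J M)"
  by (intro prob_space_PiM prob_space)

lemma (in product_prob_space) in_L2_restrict:
  assumes "in_L2 (PiM U M) g" "U \<subseteq> J" "finite J"
  shows "in_L2 (PiM J M) (\<lambda>x. g (restrict x U))"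
proof -
  have [measurable]: "(\<lambda>x. restrict x U) \<in> measurable (PiM J M) (PiM U M)"
    using \<open>U \<subseteq> J\<close> by (rule measurable_restrict_subset)
  have [measurable]: "g \<in> borel_measurable (PiM U M)"
    using assms by (simp add: in_L2_def)
  have "integrable (distr (PiM J M) (PiM U M) (\<lambda>x. restrict x U)) (\<lambda>x. (g x)\<^sup>2)"
    using assms distr_restrict[of U J] by (simp add: in_L2_def)
  then show ?thesis
    by (simp add: in_L2_def integrable_distr_eq)
qed

text \<open>Integrating out the coordinate \<open>i\<close> kills the first factor and leaves the second alone.\<close>

lemma (in product_prob_space) zero_mean_orthogonal:
  assumes "finite J" "U \<subseteq> J" "W \<subseteq> J" "i \<in> U" "i \<notin> W"
    and g: "in_L2 (PiM U M) g" and h: "in_L2 (PiM W M) h"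
    and zero: "AE z in PiM (U - {i}) M. (\<integral>t. g (z(i := t)) \<partial>M i) = 0"
  shows "inner_L2 (PiM J M) (\<lambda>x. g (restrict x U)) (\<lambda>x. h (restrict x W)) = 0"
proof -
  define K where "K = J - {i}"
  have J: "J = insert i K" and K: "finite K" "i \<notin> K" "U - {i} \<subseteq> K" "W \<subseteq> K"
    using assms by (auto simp: K_def)
  have "integrable (PiM (insert i K) M) (\<lambda>x. g (restrict x U) * h (restrict x W))"
    unfolding J[symmetric] using assms by (intro in_L2_mult_integrable in_L2_restrict)
  then have "inner_L2 (PiM J M) (\<lambda>x. g (restrict x U)) (\<lambda>x. h (restrict x W))
     = (\<integral>x. (\<integral>t. g (restrict (x(i := t)) U) * h (restrict (x(i := t)) W) \<partial>M i) \<partial>PiM K M)"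
    unfolding inner_L2_def J using K by (subst product_integral_insert) auto
  also have "\<dots> = (\<integral>x. (\<integral>t. g ((restrict x (U - {i}))(i := t)) \<partial>M i) * h (restrict x W) \<partial>PiM K M)"
  proof -
    have eq: "restrict (x(i := t)) U = (restrict x (U - {i}))(i := t)"
      "restrict (x(i := t)) W = restrict x W" for x t
      using \<open>i \<in> U\<close> \<open>i \<notin> W\<close> by (auto simp: restrict_def fun_eq_iff)
    show ?thesis by (simp only: eq integral_mult_left_zero)
  qed
  also have "\<dots> = 0"
  proof (rule integral_eq_zero_AE)
    have "AE z in distr (PiM K M) (PiM (U - {i}) M) (\<lambda>x. restrict x (U - {i})).
        (\<integral>t. g (z(i := t)) \<partial>M i) = 0"
      by (subst distr_restrict[OF K(3,1), symmetric]) (rule zero)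
    then have "AE x in PiM K M. (\<integral>t. g ((restrict x (U - {i}))(i := t)) \<partial>M i) = 0"
      by (rule AE_distrD[rotated]) (rule measurable_restrict_subset[OF K(3)])
    then show "AE x in PiM K M.
        (\<integral>t. g ((restrict x (U - {i}))(i := t)) \<partial>M i) * h (restrict x W) = 0"
      by auto
  qed
  finally show ?thesis .
qed

lemma sobol_decompositionD:
  assumes "sobol_decomposition d M f F"
  shows "\<And>U. U \<subseteq> {1..d} \<Longrightarrow> in_L2 (PiM U M) (F U)"
    and "AE x in prod_measure d M. f x = (\<Sum>U\<in>Pow {1..d}. lift F U x)"
    and "\<And>z. z \<in> space (PiM {} M) \<Longrightarrow> F {} z = mean (prod_measure d M) f"
    and "\<And>U i. U \<subseteq> {1..d} \<Longrightarrow> i \<in> U \<Longrightarrow>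
      AE z in PiM (U - {i}) M. (\<integral>t. F U (z(i := t)) \<partial>M i) = 0"
  using assms unfolding sobol_decomposition_def by blast+

text \<open>
  Rewriting \<open>1\<close> to \<open>Suc 0\<close> inside the index set \<open>{1..d}\<close> of a product measure would make rules
  about that measure inapplicable.
\<close>

declare One_nat_def [simp del]

text \<open>
  The input space with its product measure.  The factors are indexed by all natural numbers, but
  only those in \<open>{1..d}\<close> enter the measure.
\<close>

locale product_input = product_prob_space M "{1..d}"
  for d :: nat and M :: "nat \<Rightarrow> real measure"
begin

abbreviation "\<mu> \<equiv> prod_measure d M"

lemma sobol_lift_in_L2:
  assumes "sobol_decomposition d M f F" "U \<subseteq> {1..d}"
  shows "in_L2 \<mu> (lift F U)"
  by (rule in_L2_restrict[OF sobol_decompositionD(1)[OF assms] assms(2)]) simp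

lemma sobol_lift_orthogonal:
  assumes F: "sobol_decomposition d M f F" and G: "sobol_decomposition d M g G"
    and UW: "U \<subseteq> {1..d}" "W \<subseteq> {1..d}" "U \<noteq> W"
  shows "inner_L2 \<mu> (lift F U) (lift G W) = 0"
proof -
  have one: "inner_L2 \<mu> (lift F U) (lift G W) = 0"
    if F: "sobol_decomposition d M f F" and G: "sobol_decomposition d M g G"
    and "i \<in> U" "i \<notin> W" "U \<subseteq> {1..d}" "W \<subseteq> {1..d}" for f g F G U W i
    using that by (intro zero_mean_orthogonal[OF _ _ _ \<open>i \<in> U\<close> \<open>i \<notin> W\<close>]
        sobol_decompositionD(1)[OF F] sobol_decompositionD(1)[OF G] sobol_decompositionD(4)[OF F]) simp_all
  consider i where "i \<in> U" "i \<notin> W" | i where "i \<in> W" "i \<notin> U" using UW by blast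
  then show ?thesis
  proof cases
    case 1
    then show ?thesis using one[OF F G] UW by blast
  next
    case 2
    then show ?thesis using one[OF G F] UW by (subst inner_L2_commute) blast
  qed
qed

lemma sobol_lift_mean_zero:
  assumes F: "sobol_decomposition d M f F" and U: "U \<subseteq> {1..d}" "U \<noteq> {}"
  shows "mean \<mu> (lift F U) = 0"
proof -
  obtain i where i: "i \<in> U" using U by blast
  have "inner_L2 \<mu> (lift F U) (\<lambda>x. (\<lambda>_. 1) (restrict x {})) = 0"
  proof (rule zero_mean_orthogonal[OF _ U(1) _ i])
    interpret E: prob_space "PiM {} M" by (rule prob_space_PiM_all)
    show "in_L2 (PiM {} M) (\<lambda>_. 1)" by (simp add: in_L2_def)
    show "in_L2 (PiM U M) (F U)"
      "AE z in PiM (U - {i}) M. (\<integral>t. F U (z(i := t)) \<partial>M i) = 0"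
      using sobol_decompositionD(1,4)[OF F U(1)] i by auto
  qed auto
  then show ?thesis by (simp add: inner_L2_def mean_def)
qed

lemma sobol_lift_empty:
  assumes "sobol_decomposition d M f F"
  shows "lift F {} x = mean \<mu> f"
proof -
  have "restrict x {} = (\<lambda>_. undefined)" by auto
  then show ?thesis using sobol_decompositionD(3)[OF assms] by (simp add: space_PiM)
qed

text \<open>
  The bilinear form of Parseval's identity gives the distance of two functions componentwise
  (\<open>sobol_dist\<close> below) without a decomposition of their difference.
\<close>

lemma sobol_parseval:
  assumes f: "in_L2 \<mu> f" and g: "in_L2 \<mu> g"
    and F: "sobol_decomposition d M f F" and G: "sobol_decomposition d M g G"
  shows "inner_L2 \<mu> f g = (\<Sum>U\<in>Pow {1..d}. inner_L2 \<mu> (lift F U) (lift G U))"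
proof -
  have FL: "\<And>U. U \<in> Pow {1..d} \<Longrightarrow> in_L2 \<mu> (lift F U)"
    and GL: "\<And>U. U \<in> Pow {1..d} \<Longrightarrow> in_L2 \<mu> (lift G U)"
    using sobol_lift_in_L2[OF F] sobol_lift_in_L2[OF G] by auto
  have FS: "in_L2 \<mu> (\<lambda>x. \<Sum>U\<in>Pow {1..d}. lift F U x)"
    and GS: "in_L2 \<mu> (\<lambda>x. \<Sum>U\<in>Pow {1..d}. lift G U x)"
    by (intro in_L2_sum FL GL; assumption)+
  have "inner_L2 \<mu> f g
      = inner_L2 \<mu> (\<lambda>x. \<Sum>U\<in>Pow {1..d}. lift F U x) (\<lambda>x. \<Sum>U\<in>Pow {1..d}. lift G U x)"
    using f g FS GS
    by (intro inner_L2_cong_AE sobol_decompositionD(2)[OF F] sobol_decompositionD(2)[OF G])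
      (simp_all add: in_L2_def)
  also have "\<dots> = (\<Sum>U\<in>Pow {1..d}. \<Sum>W\<in>Pow {1..d}. inner_L2 \<mu> (lift F U) (lift G W))"
    by (subst inner_L2_sum_left[OF FL GS], assumption)
      (intro sum.cong refl inner_L2_sum_right FL GL)
  also have "\<dots> = (\<Sum>U\<in>Pow {1..d}. \<Sum>W\<in>Pow {1..d}.
      if W = U then inner_L2 \<mu> (lift F U) (lift G W) else 0)"
    using sobol_lift_orthogonal[OF F G] by (intro sum.cong refl) auto
  also have "\<dots> = (\<Sum>U\<in>Pow {1..d}. inner_L2 \<mu> (lift F U) (lift G U))"
    by (intro sum.cong refl) (simp add: sum.delta')
  finally show ?thesis .
qed

lemma sobol_dist:
  assumes f: "in_L2 \<mu> f" and g: "in_L2 \<mu> g"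
    and F: "sobol_decomposition d M f F" and G: "sobol_decomposition d M g G"
  shows "(norm_L2 \<mu> (\<lambda>x. f x - g x))\<^sup>2
    = (\<Sum>U\<in>Pow {1..d}. (norm_L2 \<mu> (\<lambda>x. lift F U x - lift G U x))\<^sup>2)"
proof -
  have "(\<Sum>U\<in>Pow {1..d}. (norm_L2 \<mu> (\<lambda>x. lift F U x - lift G U x))\<^sup>2)
    = (\<Sum>U\<in>Pow {1..d}. inner_L2 \<mu> (lift F U) (lift F U)
        - 2 * inner_L2 \<mu> (lift F U) (lift G U) + inner_L2 \<mu> (lift G U) (lift G U))"
    using sobol_lift_in_L2[OF F] sobol_lift_in_L2[OF G]
    by (intro sum.cong refl) (simp add: norm_L2_power2 inner_L2_diff_self)
  also have "\<dots> = inner_L2 \<mu> f f - 2 * inner_L2 \<mu> f g + inner_L2 \<mu> g g"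
    unfolding sobol_parseval[OF f f F F] sobol_parseval[OF f g F G] sobol_parseval[OF g g G G]
    by (simp add: sum.distrib sum_subtractf sum_distrib_left)
  finally show ?thesis using f g by (simp add: norm_L2_power2 inner_L2_diff_self)
qed

lemma sobol_component_var_unique:
  assumes f: "in_L2 \<mu> f"
    and F: "sobol_decomposition d M f F" and G: "sobol_decomposition d M f G"
    and U: "U \<subseteq> {1..d}"
  shows "component_var d M F U = component_var d M G U"
proof -
  have "(\<Sum>U\<in>Pow {1..d}. (norm_L2 \<mu> (\<lambda>x. lift F U x - lift G U x))\<^sup>2) = 0"
    using sobol_dist[OF f f F G] by (simp add: norm_L2_def inner_L2_def)
  then have "norm_L2 \<mu> (\<lambda>x. lift F U x - lift G U x) = 0"
    using U by (subst (asm) sum_nonneg_eq_0_iff) auto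
  then have "norm_L2 \<mu> (lift F U) = norm_L2 \<mu> (lift G U)"
    using sobol_lift_in_L2[OF F U] sobol_lift_in_L2[OF G U] by (rule norm_L2_eqI[rotated 2])
  then show ?thesis
    using norm_L2_power2[of \<mu> "lift F U"] norm_L2_power2[of \<mu> "lift G U"]
    by (simp add: component_var_def)
qed

lemma var_sobol_component:
  assumes f: "in_L2 \<mu> f" and F: "sobol_decomposition d M f F" and U: "U \<subseteq> {1..d}"
  shows "var \<mu> (sobol_component d M f U) = component_var d M F U"
proof -
  define G where "G = (SOME G. sobol_decomposition d M f G)"
  have G: "sobol_decomposition d M f G" unfolding G_def using F
    by (rule someI[where P = "sobol_decomposition d M f"])
  have comp: "sobol_component d M f U = lift G U"
    by (simp add: sobol_component_def G_def fun_eq_iff)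
  have "var \<mu> (lift G U) = component_var d M G U"
  proof (cases "U = {}")
    case True
    have "var \<mu> (lift G {}) = var \<mu> (\<lambda>_. mean \<mu> f)"
      using sobol_lift_empty[OF G] by simp
    then show ?thesis by (simp add: True component_var_def var_def mean_def P.prob_space)
  next
    case False
    then show ?thesis
      using sobol_lift_mean_zero[OF G U False] P.var_eq_inner_L2[OF sobol_lift_in_L2[OF G U]]
      by (simp add: component_var_def)
  qed
  then show ?thesis
    unfolding comp using sobol_component_var_unique[OF f F G U] by simp
qed

lemma var_eq_sum_component_var:
  assumes f: "in_L2 \<mu> f" and F: "sobol_decomposition d M f F"
  shows "var \<mu> f = (\<Sum>U\<in>Pow {1..d}. component_var d M F U)"
proof -
  have Pow: "Pow {1..d} = insert {} (Pow {1..d} - {{}})" by auto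
  have "inner_L2 \<mu> (lift F {}) (lift F {}) = inner_L2 \<mu> (\<lambda>_. mean \<mu> f) (\<lambda>_. mean \<mu> f)"
    using sobol_lift_empty[OF F] by simp
  then have "inner_L2 \<mu> (lift F {}) (lift F {}) = (mean \<mu> f)\<^sup>2"
    by (simp add: inner_L2_def P.prob_space power2_eq_square)
  then have "var \<mu> f = (\<Sum>U\<in>Pow {1..d} - {{}}. inner_L2 \<mu> (lift F U) (lift F U))"
    unfolding P.var_eq_inner_L2[OF f] sobol_parseval[OF f f F F]
    by (subst Pow, subst sum.insert) auto
  also have "\<dots> = (\<Sum>U\<in>Pow {1..d}. component_var d M F U)"
    by (subst (2) Pow, subst sum.insert) (auto simp: component_var_def intro!: sum.cong)
  finally show ?thesis .
qed

end

section \<open>Perturbation of variance shares\<close>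

lemma sqrt_sum_diff_power2_le:
  fixes a b :: "'i \<Rightarrow> real"
  shows "(sqrt (\<Sum>i\<in>T. (a i)\<^sup>2) - sqrt (\<Sum>i\<in>T. (b i)\<^sup>2))\<^sup>2 \<le> (\<Sum>i\<in>T. (a i - b i)\<^sup>2)"
proof -
  let ?A = "\<Sum>i\<in>T. (a i)\<^sup>2" and ?B = "\<Sum>i\<in>T. (b i)\<^sup>2"
  have "(\<Sum>i\<in>T. a i * b i)\<^sup>2 \<le> ?A * ?B"
    by (rule Cauchy_Schwarz_ineq_sum)
  then have "(\<Sum>i\<in>T. a i * b i) \<le> sqrt (?A * ?B)"
    by (rule real_le_rsqrt)
  moreover have "(sqrt ?A - sqrt ?B)\<^sup>2 = ?A + ?B - 2 * sqrt (?A * ?B)"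
    by (simp add: power2_diff real_sqrt_mult sum_nonneg)
  moreover have "(\<Sum>i\<in>T. (a i - b i)\<^sup>2) = ?A + ?B - 2 * (\<Sum>i\<in>T. a i * b i)"
    by (simp add: power2_diff sum.distrib sum_subtractf sum_distrib_left mult.assoc)
  ultimately show ?thesis by linarith
qed

context product_input
begin

text \<open>The reverse triangle inequality in the orthogonal sum of the components in \<open>T\<close>.\<close>

lemma component_share_dist:
  assumes f: "in_L2 \<mu> f" and g: "in_L2 \<mu> g"
    and F: "sobol_decomposition d M f F" and G: "sobol_decomposition d M g G"
    and T: "T \<subseteq> Pow {1..d}"
  shows "(sqrt (\<Sum>U\<in>T. component_var d M F U) - sqrt (\<Sum>U\<in>T. component_var d M G U))\<^sup>2
    \<le> (\<Sum>U\<in>T. (norm_L2 \<mu> (\<lambda>x. lift F U x - lift G U x))\<^sup>2)"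
proof -
  let ?a = "\<lambda>F U. sqrt (component_var d M F U)"
  have "(?a F U - ?a G U)\<^sup>2 \<le> (norm_L2 \<mu> (\<lambda>x. lift F U x - lift G U x))\<^sup>2" if "U \<in> T" for U
  proof (cases "U = {}")
    case True
    then show ?thesis by (simp add: component_var_def)
  next
    case False
    then show ?thesis
      using norm_L2_diff_lower[of \<mu> "lift F U" "lift G U"] that T
        sobol_lift_in_L2[OF F] sobol_lift_in_L2[OF G]
      by (auto simp: component_var_def norm_L2_def)
  qed
  then have "(\<Sum>U\<in>T. (?a F U - ?a G U)\<^sup>2)
      \<le> (\<Sum>U\<in>T. (norm_L2 \<mu> (\<lambda>x. lift F U x - lift G U x))\<^sup>2)"
    by (rule sum_mono)
  with sqrt_sum_diff_power2_le[of "?a F" T "?a G"] show ?thesis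
    by (simp add: component_var_nonneg)
qed

text \<open>
  The number \<open>c\<close> is the value given by convention to the share of a function of variance zero.
\<close>

lemma share_perturbation:
  assumes f: "in_L2 \<mu> f" and g: "in_L2 \<mu> g"
    and F: "sobol_decomposition d M f F" and G: "sobol_decomposition d M g G"
    and T: "T \<subseteq> Pow {1..d}" and var_f: "var \<mu> f > 0" and c: "0 \<le> c" "c \<le> 1"
  defines "S \<equiv> (\<Sum>U\<in>T. component_var d M F U) / var \<mu> f"
    and "S' \<equiv> (if var \<mu> g = 0 then c else (\<Sum>U\<in>T. component_var d M G U) / var \<mu> g)"
    and "e \<equiv> (norm_L2 \<mu> (\<lambda>x. f x - g x))\<^sup>2 / var \<mu> f"
  shows "0 \<le> S" "S \<le> 1" "0 \<le> S'" "S' \<le> 1" "(S - S')\<^sup>2 \<le> e" "\<bar>S - S'\<bar> \<le> e + 2 * sqrt S * sqrt e"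
proof -
  define R where "R = Pow {1..d} - T"
  have split: "sum h (Pow {1..d}) = sum h T + sum h R" for h :: "nat set \<Rightarrow> real"
    unfolding R_def using T by (simp add: sum.subset_diff[of T])
  define p q r s where "p = sqrt (\<Sum>U\<in>T. component_var d M F U)"
    and "q = sqrt (\<Sum>U\<in>R. component_var d M F U)"
    and "r = sqrt (\<Sum>U\<in>T. component_var d M G U)"
    and "s = sqrt (\<Sum>U\<in>R. component_var d M G U)"
  have nonneg: "p \<ge> 0" "q \<ge> 0" "r \<ge> 0" "s \<ge> 0"
    by (auto simp: p_def q_def r_def s_def intro!: sum_nonneg component_var_nonneg)
  have sq: "p\<^sup>2 = (\<Sum>U\<in>T. component_var d M F U)" "r\<^sup>2 = (\<Sum>U\<in>T. component_var d M G U)"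
    and vf: "p\<^sup>2 + q\<^sup>2 = var \<mu> f" and vg: "r\<^sup>2 + s\<^sup>2 = var \<mu> g"
    unfolding var_eq_sum_component_var[OF f F] var_eq_sum_component_var[OF g G]
    by (auto simp: p_def q_def r_def s_def split sum_nonneg component_var_nonneg)
  have S: "S = p\<^sup>2 / (p\<^sup>2 + q\<^sup>2)" and S': "S' = (if r\<^sup>2 + s\<^sup>2 = 0 then c else r\<^sup>2 / (r\<^sup>2 + s\<^sup>2))"
    unfolding S_def S'_def vf vg unfolding sq by (rule refl)+
  have "(p - r)\<^sup>2 + (q - s)\<^sup>2 \<le> (norm_L2 \<mu> (\<lambda>x. f x - g x))\<^sup>2"
    unfolding sobol_dist[OF f g F G] split p_def q_def r_def s_def
    by (intro add_mono component_share_dist[OF f g F G] T) (simp add: R_def)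
  then have dist: "(p - r)\<^sup>2 + (q - s)\<^sup>2 \<le> e * (p\<^sup>2 + q\<^sup>2)"
    unfolding vf e_def using var_f by simp
  have e: "e \<ge> 0" unfolding e_def using var_f by simp
  show range: "0 \<le> S" "S \<le> 1" "0 \<le> S'" "S' \<le> 1"
    unfolding S S' using c by (auto simp: divide_le_eq_1 intro: add_nonneg_pos add_pos_nonneg)
  have "(S - S')\<^sup>2 \<le> e \<and> \<bar>S - S'\<bar> \<le> e + 2 * sqrt S * sqrt e"
  proof (cases "r\<^sup>2 + s\<^sup>2 = 0")
    case True
    \<comment> \<open>The function \<open>g\<close> is almost everywhere constant, so its distance from \<open>f\<close>, squared, is at least the variance of \<open>f\<close>.\<close>
    then have "r = 0" "s = 0" by (auto simp: add_nonneg_eq_0_iff)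
    then have "1 * (p\<^sup>2 + q\<^sup>2) \<le> e * (p\<^sup>2 + q\<^sup>2)" using dist by simp
    then have "1 \<le> e" using var_f unfolding vf by simp
    moreover have diff: "\<bar>S - S'\<bar> \<le> 1" using range by linarith
    moreover have "(S - S')\<^sup>2 \<le> 1" using diff by (simp add: abs_square_le_1)
    moreover have "0 \<le> 2 * sqrt S * sqrt e" using range e by simp
    ultimately show ?thesis by linarith
  next
    case False
    then have W: "r\<^sup>2 + s\<^sup>2 > 0" by (metis add_nonneg_nonneg order_le_less zero_le_power2)
    have V: "p\<^sup>2 + q\<^sup>2 > 0" using var_f vf by simp
    show ?thesis
      using share_diff_bounds[OF nonneg V W e dist] unfolding S S' if_not_P[OF False] by simp
  qed
  then show "(S - S')\<^sup>2 \<le> e" "\<bar>S - S'\<bar> \<le> e + 2 * sqrt S * sqrt e" by auto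
qed

text \<open>Both kinds of index are the share of the variance captured by a family \<open>T\<close> of components.\<close>

lemma index_eq_share:
  assumes "index = sobol_index d M \<or> index = total_effect_index d M" "U \<subseteq> {1..d}"
  obtains T where "T \<subseteq> Pow {1..d}"
    and "\<And>f F. in_L2 \<mu> f \<Longrightarrow> sobol_decomposition d M f F \<Longrightarrow> index f U
      = (if var \<mu> f = 0 then 1 / 2 ^ d else (\<Sum>W\<in>T. component_var d M F W) / var \<mu> f)"
  using assms(1)
proof
  assume "index = sobol_index d M"
  with assms(2) show thesis
    by (intro that[of "{U}"]) (simp_all add: sobol_index_def var_sobol_component[OF _ _ assms(2)])
next
  assume index: "index = total_effect_index d M"
  show thesis
  proof (rule that[of "{W. W \<subseteq> {1..d} \<and> W \<inter> U \<noteq> {}}"])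
    fix f F assume fF: "in_L2 \<mu> f" "sobol_decomposition d M f F"
    have "(\<Sum>W | W \<subseteq> {1..d} \<and> W \<inter> U \<noteq> {}. sobol_index d M f W)
      = (\<Sum>W | W \<subseteq> {1..d} \<and> W \<inter> U \<noteq> {}. component_var d M F W / var \<mu> f)" if "var \<mu> f \<noteq> 0"
      using that by (intro sum.cong refl) (auto simp: sobol_index_def var_sobol_component[OF fF])
    then show "index f U = (if var \<mu> f = 0 then 1 / 2 ^ d
        else (\<Sum>W | W \<subseteq> {1..d} \<and> W \<inter> U \<noteq> {}. component_var d M F W) / var \<mu> f)"
      by (simp add: index total_effect_index_def sum_divide_distrib)
  qed auto
qed

section \<open>Existence of the decomposition for bounded functions\<close>

text \<open>
  The mean of \<open>f\<close> given the coordinates in \<open>V\<close>, written as an average over an independent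
  copy \<open>y\<close> of the whole point whose coordinates in \<open>V\<close> are replaced by those of \<open>x\<close>.
\<close>

definition conditional_mean :: "((nat \<Rightarrow> real) \<Rightarrow> real) \<Rightarrow> nat set \<Rightarrow> (nat \<Rightarrow> real) \<Rightarrow> real"
  where "conditional_mean f V x = (\<integral>y. f (\<lambda>i\<in>{1..d}. if i \<in> V then x i else y i) \<partial>\<mu>)"

text \<open>
  The Sobol component of \<open>f\<close>: the alternating sum of the conditional means over the subsets
  \<open>V\<close> of \<open>U\<close>, with sign \<open>(-1)\<close> to the power \<open>card (U - V)\<close>.
\<close>

definition moebius_component :: "((nat \<Rightarrow> real) \<Rightarrow> real) \<Rightarrow> nat set \<Rightarrow> (nat \<Rightarrow> real) \<Rightarrow> real"
  where "moebius_component f U x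
    = (-1) ^ card U * (\<Sum>V\<in>Pow U. (-1) ^ card V * conditional_mean f V x)"

lemma measurable_hybrid_point:
  assumes "V \<subseteq> U" "U \<subseteq> {1..d}"
  shows "(\<lambda>(x, y). \<lambda>i\<in>{1..d}. if i \<in> V then x i else y i)
    \<in> measurable (PiM U M \<Otimes>\<^sub>M \<mu>) \<mu>"
  unfolding case_prod_beta
proof (rule measurable_restrict)
  fix i assume i: "i \<in> {1..d}"
  show "(\<lambda>z. if i \<in> V then fst z i else snd z i) \<in> measurable (PiM U M \<Otimes>\<^sub>M \<mu>) (M i)"
  proof (cases "i \<in> V")
    case True
    then have "i \<in> U" using assms by blast
    then show ?thesis using True by simp
  next
    case False
    then show ?thesis using i by simp
  qed
qed

lemma conditional_mean_measurable:
  assumes [measurable]: "f \<in> borel_measurable \<mu>" and VU: "V \<subseteq> U" "U \<subseteq> {1..d}"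
  shows "conditional_mean f V \<in> borel_measurable (PiM U M)"
proof -
  have "(\<lambda>(x, y). f (\<lambda>i\<in>{1..d}. if i \<in> V then x i else y i)) \<in> borel_measurable (PiM U M \<Otimes>\<^sub>M \<mu>)"
    using measurable_compose[OF measurable_hybrid_point[OF VU] assms(1)]
    by (simp add: case_prod_beta)
  then show ?thesis
    unfolding conditional_mean_def[abs_def] by (rule P.borel_measurable_lebesgue_integral)
qed

lemma hybrid_point_in_space:
  assumes "V \<subseteq> U" "U \<subseteq> {1..d}" "x \<in> space (PiM U M)" "y \<in> space \<mu>"
  shows "(\<lambda>i\<in>{1..d}. if i \<in> V then x i else y i) \<in> space \<mu>"
  using measurable_space[OF measurable_hybrid_point[OF assms(1,2)], of "(x, y)"] assms(3,4)
  by (simp add: space_pair_measure)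

lemma hybrid_point_measurable_right:
  assumes "V \<subseteq> U" "U \<subseteq> {1..d}" "x \<in> space (PiM U M)"
  shows "(\<lambda>y. \<lambda>i\<in>{1..d}. if i \<in> V then x i else y i) \<in> measurable \<mu> \<mu>"
  using measurable_compose[OF measurable_Pair1'[OF assms(3)] measurable_hybrid_point[OF assms(1,2)]]
  by simp

lemma conditional_mean_bounded:
  assumes f: "f \<in> borel_measurable \<mu>" and B: "\<And>x. x \<in> space \<mu> \<Longrightarrow> \<bar>f x\<bar> \<le> B"
    and VU: "V \<subseteq> U" "U \<subseteq> {1..d}" and x: "x \<in> space (PiM U M)"
  shows "\<bar>conditional_mean f V x\<bar> \<le> B"
proof -
  let ?h = "\<lambda>y. f (\<lambda>i\<in>{1..d}. if i \<in> V then x i else y i)"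
  have h: "?h \<in> borel_measurable \<mu>"
    using hybrid_point_measurable_right[OF VU x] f by (rule measurable_compose)
  have bound: "\<bar>?h y\<bar> \<le> B" if "y \<in> space \<mu>" for y
    using that by (intro B hybrid_point_in_space[OF VU x])
  have int: "integrable \<mu> ?h"
    by (rule P.integrable_const_bound[where B = B]) (use bound h in auto)
  have "\<bar>conditional_mean f V x\<bar> \<le> (\<integral>y. \<bar>?h y\<bar> \<partial>\<mu>)"
    unfolding conditional_mean_def by (rule integral_abs_bound)
  also have "\<dots> \<le> (\<integral>y. B \<partial>\<mu>)"
    using int bound by (intro integral_mono) auto
  finally show ?thesis by (simp add: P.prob_space)
qed

text \<open>Refreshing one coordinate of a random point by an independent copy changes no mean.\<close>

lemma integral_refresh_coordinate:
  fixes h :: "(nat \<Rightarrow> real) \<Rightarrow> real"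
  assumes h: "h \<in> borel_measurable \<mu>" and B: "\<And>x. x \<in> space \<mu> \<Longrightarrow> \<bar>h x\<bar> \<le> B"
    and i: "i \<in> {1..d}"
  shows "(\<integral>t. (\<integral>y. h (y(i := t)) \<partial>\<mu>) \<partial>M i) = (\<integral>y. h y \<partial>\<mu>)"
proof -
  define K where "K = {1..d} - {i}"
  interpret K: prob_space "PiM K M" by (rule prob_space_PiM_all)
  interpret iK: pair_prob_space "M i" "PiM K M" ..
  have ins: "{1..d} = insert i K" using i by (auto simp: K_def)
  have upd [measurable]: "(\<lambda>(t, x). x(i := t)) \<in> measurable (M i \<Otimes>\<^sub>M PiM K M) \<mu>"
    unfolding case_prod_beta ins by (rule measurable_fun_upd[where J = K]) auto
  have meas: "(\<lambda>(t, x). h (x(i := t))) \<in> borel_measurable (M i \<Otimes>\<^sub>M PiM K M)"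
    using measurable_compose[OF upd h] by (simp add: case_prod_beta)
  have int: "integrable (M i \<Otimes>\<^sub>M PiM K M) (\<lambda>(t, x). h (x(i := t)))"
  proof (rule iK.integrable_const_bound[where B = B])
    show "AE z in M i \<Otimes>\<^sub>M PiM K M. norm (case z of (t, x) \<Rightarrow> h (x(i := t))) \<le> B"
    proof (rule AE_I2)
      fix z assume "z \<in> space (M i \<Otimes>\<^sub>M PiM K M)"
      from B[OF measurable_space[OF upd this]]
      show "norm (case z of (t, x) \<Rightarrow> h (x(i := t))) \<le> B" by (simp add: case_prod_beta)
    qed
  qed (fact meas)
  have "(\<integral>y. h y \<partial>\<mu>) = (\<integral>y. h y \<partial>distr (M i \<Otimes>\<^sub>M PiM K M) \<mu> (\<lambda>(t, x). x(i := t)))"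
    using distr_pair_PiM_eq_PiM[of K M i] prob_space unfolding ins by simp
  also have "\<dots> = (\<integral>z. h (case z of (t, x) \<Rightarrow> x(i := t)) \<partial>(M i \<Otimes>\<^sub>M PiM K M))"
    by (rule integral_distr[OF upd h])
  also have "\<dots> = (\<integral>t. (\<integral>x. h (x(i := t)) \<partial>PiM K M) \<partial>M i)"
    using iK.integral_fst[OF int] by (simp add: case_prod_unfold)
  also have "\<dots> = (\<integral>t. (\<integral>y. h (y(i := t)) \<partial>\<mu>) \<partial>M i)"
  proof (rule Bochner_Integration.integral_cong[OF refl])
    fix t assume t: "t \<in> space (M i)"
    have res: "(\<lambda>y. restrict y K) \<in> measurable \<mu> (PiM K M)"
      by (rule measurable_restrict_subset) (auto simp: K_def)
    have "(\<lambda>x. x(i := t)) \<in> measurable (PiM K M) \<mu>"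
      unfolding ins by (rule measurable_fun_upd[where J = K]) (use t in auto)
    from measurable_compose[OF this h]
    have "(\<integral>x. h (x(i := t)) \<partial>distr \<mu> (PiM K M) (\<lambda>y. restrict y K))
        = (\<integral>y. h ((restrict y K)(i := t)) \<partial>\<mu>)"
      by (rule integral_distr[OF res])
    also have "distr \<mu> (PiM K M) (\<lambda>y. restrict y K) = PiM K M"
      by (rule distr_restrict[symmetric]) (auto simp: K_def)
    also have "(\<integral>y. h ((restrict y K)(i := t)) \<partial>\<mu>) = (\<integral>y. h (y(i := t)) \<partial>\<mu>)"
    proof (rule Bochner_Integration.integral_cong[OF refl])
      fix y assume "y \<in> space \<mu>"
      then have "(restrict y K)(i := t) = y(i := t)"
        by (auto simp: space_PiM PiE_iff extensional_def K_def fun_eq_iff)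
      then show "h ((restrict y K)(i := t)) = h (y(i := t))" by simp
    qed
    finally show "(\<integral>x. h (x(i := t)) \<partial>PiM K M) = (\<integral>y. h (y(i := t)) \<partial>\<mu>)" .
  qed
  finally show ?thesis by simp
qed

text \<open>The tower property: averaging out the coordinate \<open>i\<close> undoes conditioning on it.\<close>

lemma conditional_mean_tower:
  assumes f: "f \<in> borel_measurable \<mu>" and B: "\<And>x. x \<in> space \<mu> \<Longrightarrow> \<bar>f x\<bar> \<le> B"
    and V: "V \<subseteq> U - {i}" "U \<subseteq> {1..d}" and i: "i \<in> U" and z: "z \<in> space (PiM (U - {i}) M)"
  shows "(\<integral>t. conditional_mean f (insert i V) (z(i := t)) \<partial>M i) = conditional_mean f V z"
proof -
  let ?h = "\<lambda>y. f (\<lambda>j\<in>{1..d}. if j \<in> V then z j else y j)"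
  have V': "V \<subseteq> U - {i}" "U - {i} \<subseteq> {1..d}" using V by auto
  have "(\<lambda>j\<in>{1..d}. if j \<in> insert i V then (z(i := t)) j else y j)
      = (\<lambda>j\<in>{1..d}. if j \<in> V then z j else (y(i := t)) j)" for t y
    using V by (auto simp: restrict_def fun_eq_iff)
  then have "(\<integral>t. conditional_mean f (insert i V) (z(i := t)) \<partial>M i)
      = (\<integral>t. (\<integral>y. ?h (y(i := t)) \<partial>\<mu>) \<partial>M i)"
    unfolding conditional_mean_def by (simp only:)
  also have "\<dots> = (\<integral>y. ?h y \<partial>\<mu>)"
  proof (rule integral_refresh_coordinate[where B = B])
    show "?h \<in> borel_measurable \<mu>"
      using hybrid_point_measurable_right[OF V' z] f by (rule measurable_compose)
    show "\<bar>?h y\<bar> \<le> B" if "y \<in> space \<mu>" for y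
      using that by (intro B hybrid_point_in_space[OF V' z])
  qed (use i V in auto)
  finally show ?thesis unfolding conditional_mean_def .
qed

lemma moebius_component_zero_mean:
  assumes f: "f \<in> borel_measurable \<mu>" and B: "\<And>x. x \<in> space \<mu> \<Longrightarrow> \<bar>f x\<bar> \<le> B"
    and U: "U \<subseteq> {1..d}" "i \<in> U" and z: "z \<in> space (PiM (U - {i}) M)"
  shows "(\<integral>t. moebius_component f U (z(i := t)) \<partial>M i) = 0"
proof -
  let ?c = "conditional_mean f" and ?W = "Pow (U - {i})"
  have fin: "finite U" using U finite_subset by blast
  have upd: "(\<lambda>t. z(i := t)) \<in> measurable (M i) (PiM U M)"
    by (rule measurable_fun_upd[where J = "U - {i}"]) (use U z in auto)
  have int: "integrable (M i) (\<lambda>t. ?c V (z(i := t)))" if V: "V \<subseteq> U" for V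
  proof (rule M.integrable_const_bound[where B = B])
    show "(\<lambda>t. ?c V (z(i := t))) \<in> borel_measurable (M i)"
      using upd conditional_mean_measurable[OF f V U(1)] by (rule measurable_compose)
    show "AE t in M i. norm (?c V (z(i := t))) \<le> B"
      using conditional_mean_bounded[OF f B V U(1) measurable_space[OF upd]]
      by (intro AE_I2) simp
  qed
  \<comment> \<open>The subsets of \<open>U\<close> pair up as \<open>V\<close> and \<open>insert i V\<close>, with opposite signs.\<close>
  have Pow: "Pow U = ?W \<union> insert i ` ?W"
  proof -
    have "U = insert i (U - {i})" using U by blast
    then show ?thesis using Pow_insert[of i "U - {i}"] by simp
  qed
  have inj: "inj_on (insert i) ?W"
    by (rule inj_onI) (metis Diff_insert_absorb DiffE PowD insertI1 subset_eq)
  have card: "card (insert i V) = Suc (card V)" if "V \<in> ?W" for V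
    using that fin by (intro card_insert_disjoint) (auto dest: finite_subset)
  have "(\<Sum>V\<in>Pow U. (-1) ^ card V * ?c V x)
      = (\<Sum>V\<in>?W. (-1) ^ card V * ?c V x) + (\<Sum>V\<in>insert i ` ?W. (-1) ^ card V * ?c V x)" for x
    unfolding Pow using fin by (intro sum.union_disjoint) auto
  also have "\<dots> x = (\<Sum>V\<in>?W. (-1) ^ card V * (?c V x - ?c (insert i V) x))" for x
    using card by (simp add: sum.reindex[OF inj] sum.distrib[symmetric] right_diff_distrib)
  finally have pairs: "(\<Sum>V\<in>Pow U. (-1) ^ card V * ?c V x)
      = (\<Sum>V\<in>?W. (-1) ^ card V * (?c V x - ?c (insert i V) x))" for x .
  have "(\<integral>t. ?c V (z(i := t)) - ?c (insert i V) (z(i := t)) \<partial>M i) = 0" if "V \<in> ?W" for V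
  proof -
    have "?c V (z(i := t)) = ?c V z" for t
      unfolding conditional_mean_def using that
      by (intro Bochner_Integration.integral_cong[OF refl] arg_cong[where f = f])
        (auto simp: restrict_def fun_eq_iff)
    moreover have "(\<integral>t. ?c (insert i V) (z(i := t)) \<partial>M i) = ?c V z"
      using that by (intro conditional_mean_tower[OF f B _ U z]) auto
    moreover have "integrable (M i) (\<lambda>t. ?c (insert i V) (z(i := t)))"
      using that U by (intro int) auto
    ultimately show ?thesis by (simp add: M.prob_space)
  qed
  moreover have "integrable (M i) (\<lambda>t. ?c V (z(i := t)) - ?c (insert i V) (z(i := t)))"
    if "V \<in> ?W" for V
    using that U by (intro Bochner_Integration.integrable_diff int) auto
  ultimately show ?thesis
    unfolding moebius_component_def pairs by simp
qed

text \<open>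
  By Moebius inversion over the lattice of subsets the components sum to
  \<open>conditional_mean f {1..d} = f\<close>.
\<close>

lemma sobol_decomposition_bounded:
  assumes f: "f \<in> borel_measurable \<mu>" and B: "\<And>x. x \<in> space \<mu> \<Longrightarrow> \<bar>f x\<bar> \<le> B"
  shows "sobol_decomposition d M f (moebius_component f)"
  unfolding sobol_decomposition_def
proof (intro conjI allI impI ballI)
  fix U assume U: "U \<subseteq> {1..d}"
  interpret U: prob_space "PiM U M" by (rule prob_space_PiM_all)
  have "in_L2 (PiM U M) (\<lambda>x. (-1) ^ card V * conditional_mean f V x)" if "V \<in> Pow U" for V
    using that by (intro in_L2_cmult U.in_L2_bounded[where B = B]
        conditional_mean_measurable[OF f _ U] conditional_mean_bounded[OF f B _ U]) auto
  then show "in_L2 (PiM U M) (moebius_component f U)"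
    unfolding moebius_component_def[abs_def] by (rule in_L2_cmult[OF in_L2_sum])
  show "AE z in PiM (U - {i}) M. (\<integral>t. moebius_component f U (z(i := t)) \<partial>M i) = 0"
    if "i \<in> U" for i
    using moebius_component_zero_mean[OF f B U that] by (rule AE_I2)
next
  show "AE x in \<mu>. f x = (\<Sum>U\<in>Pow {1..d}. lift (moebius_component f) U x)"
  proof (rule AE_I2)
    fix x assume x: "x \<in> space \<mu>"
    have "lift (moebius_component f) U x = moebius_component f U x" for U
    proof -
      have "conditional_mean f V (restrict x U) = conditional_mean f V x" if "V \<subseteq> U" for V
        unfolding conditional_mean_def using that
        by (intro Bochner_Integration.integral_cong[OF refl] arg_cong[where f = f])
          (auto simp: restrict_def fun_eq_iff)
      then show ?thesis by (simp add: moebius_component_def)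
    qed
    then have "(\<Sum>U\<in>Pow {1..d}. lift (moebius_component f) U x)
        = (\<Sum>U\<in>Pow {1..d}. moebius_component f U x)" by simp
    also have "\<dots> = (\<Sum>U\<in>Pow {1..d}. (-1) ^ card U * ((-1) ^ card U * moebius_component f U x))"
      by (simp flip: mult.assoc power_add)
    also have "\<dots> = conditional_mean f {1..d} x"
      by (rule inclusion_exclusion_symmetric[symmetric])
        (simp_all add: moebius_component_def flip: mult.assoc power_add)
    also have "\<dots> = (\<integral>y. f x \<partial>\<mu>)"
      unfolding conditional_mean_def using x
      by (intro Bochner_Integration.integral_cong[OF refl] arg_cong[where f = f])
        (auto simp: space_PiM PiE_iff extensional_def restrict_def fun_eq_iff)
    finally show "f x = (\<Sum>U\<in>Pow {1..d}. lift (moebius_component f) U x)"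
      by (simp add: P.prob_space)
  qed
next
  fix z :: "nat \<Rightarrow> real"
  have "conditional_mean f {} z = mean \<mu> f"
    unfolding conditional_mean_def mean_def
    by (intro Bochner_Integration.integral_cong[OF refl] arg_cong[where f = f])
      (auto simp: space_PiM PiE_iff extensional_def restrict_def fun_eq_iff)
  then show "moebius_component f {} z = mean \<mu> f" by (simp add: moebius_component_def)
qed

end

section \<open>Tensor-product regressors\<close>

text \<open>The set of coordinates on which a regressor depends.\<close>

definition index_support :: "nat \<Rightarrow> (nat \<Rightarrow> nat) \<Rightarrow> nat set"
  where "index_support d \<alpha> = {i \<in> {1..d}. \<alpha> i \<noteq> 0}"

text \<open>
  The part of the expansion \<open>\<Sum>\<alpha>\<in>A. c \<alpha> \<Psi>\<^sub>\<alpha>\<close> that belongs to the component \<open>U\<close>; the factors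
  outside \<open>U\<close> are \<open>\<psi>\<^sub>0 = 1\<close>.
\<close>

definition expansion_component ::
  "nat \<Rightarrow> (nat \<Rightarrow> nat \<Rightarrow> real \<Rightarrow> real) \<Rightarrow> (nat \<Rightarrow> nat) set \<Rightarrow> ((nat \<Rightarrow> nat) \<Rightarrow> real)
     \<Rightarrow> nat set \<Rightarrow> (nat \<Rightarrow> real) \<Rightarrow> real"
  where "expansion_component d \<psi> A c U z =
    (\<Sum>\<alpha>\<in>{\<alpha>\<in>A. index_support d \<alpha> = U}. c \<alpha> * (\<Prod>i\<in>U. \<psi> i (\<alpha> i) (z i)))"

text \<open>Orthonormal families on the factors, starting with the constant function 1.\<close>

locale tensor_basis = product_input d M
  for d :: nat and M :: "nat \<Rightarrow> real measure" +
  fixes \<psi> :: "nat \<Rightarrow> nat \<Rightarrow> real \<Rightarrow> real"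
  assumes orthonormal: "\<And>i. i \<in> {1..d} \<Longrightarrow> orthonormal_family (M i) (\<psi> i)"
    and psi_0: "\<And>i t. i \<in> {1..d} \<Longrightarrow> t \<in> space (M i) \<Longrightarrow> \<psi> i 0 t = 1"
begin

abbreviation "\<Psi> \<equiv> tensor_regressor d \<psi>"

text \<open>The finite expansion with index set \<open>A\<close> and coefficients \<open>c\<close>.\<close>

abbreviation "expansion A c \<equiv> (\<lambda>x. \<Sum>\<alpha>\<in>A. c \<alpha> * \<Psi> \<alpha> x)"

lemma psi_in_L2: "i \<in> {1..d} \<Longrightarrow> in_L2 (M i) (\<psi> i k)"
  using orthonormal by (simp add: orthonormal_family_def)

lemma psi_inner: "i \<in> {1..d} \<Longrightarrow> inner_L2 (M i) (\<psi> i j) (\<psi> i k) = (if j = k then 1 else 0)"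
  using orthonormal by (simp add: orthonormal_family_def)

lemma psi_integral:
  assumes "i \<in> {1..d}"
  shows "(\<integral>t. \<psi> i k t \<partial>M i) = (if k = 0 then 1 else 0)"
proof -
  have "inner_L2 (M i) (\<psi> i k) (\<psi> i 0) = (\<integral>t. \<psi> i k t \<partial>M i)"
    unfolding inner_L2_def using psi_0[OF assms]
    by (intro Bochner_Integration.integral_cong) auto
  then show ?thesis using psi_inner[OF assms] by simp
qed

lemma psi_prod_in_L2:
  assumes "U \<subseteq> {1..d}"
  shows "in_L2 (PiM U M) (\<lambda>z. \<Prod>i\<in>U. \<psi> i (\<alpha> i) (z i))"
proof -
  have fin: "finite U" using assms by (rule finite_subset) simp
  have meas: "(\<lambda>z. \<psi> i (\<alpha> i) (z i)) \<in> borel_measurable (PiM U M)" if "i \<in> U" for i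
  proof (rule measurable_compose[OF measurable_component_singleton[OF that]])
    show "\<psi> i (\<alpha> i) \<in> borel_measurable (M i)"
      using psi_in_L2[of i "\<alpha> i"] that assms by (auto simp: in_L2_def)
  qed
  have "integrable (PiM U M) (\<lambda>z. \<Prod>i\<in>U. (\<psi> i (\<alpha> i) (z i))\<^sup>2)"
    using psi_in_L2 assms by (intro product_integrable_prod[OF fin]) (auto simp: in_L2_def)
  then show ?thesis
    unfolding in_L2_def using meas by (auto simp: prod_power_distrib intro!: borel_measurable_prod)
qed

lemma tensor_in_L2: "in_L2 \<mu> (\<Psi> \<alpha>)"
  using psi_prod_in_L2[of "{1..d}" \<alpha>] by (simp add: tensor_regressor_def[abs_def])

lemma tensor_mean: "mean \<mu> (\<Psi> \<alpha>) = (if index_support d \<alpha> = {} then 1 else 0)"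
proof -
  have "mean \<mu> (\<Psi> \<alpha>) = (\<Prod>i\<in>{1..d}. \<integral>t. \<psi> i (\<alpha> i) t \<partial>M i)"
    unfolding mean_def tensor_regressor_def
    by (rule product_integral_prod[OF finite_atLeastAtMost])
      (rule M.in_L2_integrable[OF psi_in_L2])
  also have "\<dots> = (\<Prod>i\<in>{1..d}. if \<alpha> i = 0 then 1 else 0)"
    by (intro prod.cong refl psi_integral)
  also have "\<dots> = (if index_support d \<alpha> = {} then 1 else 0)"
    by (auto simp: index_support_def)
  finally show ?thesis .
qed

lemma tensor_inner:
  assumes "\<alpha> \<in> multi_indices d" "\<beta> \<in> multi_indices d"
  shows "inner_L2 \<mu> (\<Psi> \<alpha>) (\<Psi> \<beta>) = (if \<alpha> = \<beta> then 1 else 0)"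
proof -
  have "inner_L2 \<mu> (\<Psi> \<alpha>) (\<Psi> \<beta>) = (\<Prod>i\<in>{1..d}. \<integral>t. \<psi> i (\<alpha> i) t * \<psi> i (\<beta> i) t \<partial>M i)"
    unfolding inner_L2_def tensor_regressor_def prod.distrib[symmetric]
    by (rule product_integral_prod[OF finite_atLeastAtMost])
      (intro in_L2_mult_integrable psi_in_L2)
  also have "\<dots> = (\<Prod>i\<in>{1..d}. if \<alpha> i = \<beta> i then 1 else 0)"
    by (intro prod.cong refl psi_inner[unfolded inner_L2_def])
  also have "\<dots> = (if \<forall>i\<in>{1..d}. \<alpha> i = \<beta> i then 1 else 0)"
    by auto
  also have "(\<forall>i\<in>{1..d}. \<alpha> i = \<beta> i) \<longleftrightarrow> \<alpha> = \<beta>"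
    using assms by (auto intro: PiE_ext)
  finally show ?thesis .
qed

lemma tensor_eq_prod_support:
  assumes "x \<in> space \<mu>"
  shows "\<Psi> \<alpha> x = (\<Prod>i\<in>index_support d \<alpha>. \<psi> i (\<alpha> i) (x i))"
  unfolding tensor_regressor_def
proof (rule prod.mono_neutral_right)
  show "\<forall>i\<in>{1..d} - index_support d \<alpha>. \<psi> i (\<alpha> i) (x i) = 1"
    using assms by (auto simp: index_support_def space_PiM PiE_iff intro!: psi_0)
qed (auto simp: index_support_def)

lemma expansion_in_L2: "in_L2 \<mu> (expansion A c)"
  by (rule in_L2_sum) (rule in_L2_cmult[OF tensor_in_L2])

lemma inner_expansion_right:
  assumes "in_L2 \<mu> f"
  shows "inner_L2 \<mu> f (expansion A b) = (\<Sum>\<alpha>\<in>A. b \<alpha> * inner_L2 \<mu> f (\<Psi> \<alpha>))"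
  by (subst inner_L2_sum_right[OF in_L2_cmult[OF tensor_in_L2] assms])
    (simp add: inner_L2_cmult_right)

lemma norm_expansion:
  assumes A: "A \<subseteq> multi_indices d" "finite A"
  shows "inner_L2 \<mu> (expansion A b) (expansion A b) = (\<Sum>\<alpha>\<in>A. (b \<alpha>)\<^sup>2)"
proof -
  have "inner_L2 \<mu> (expansion A b) (\<Psi> \<alpha>) = b \<alpha>" if \<alpha>: "\<alpha> \<in> A" for \<alpha>
  proof -
    have "inner_L2 \<mu> (expansion A b) (\<Psi> \<alpha>) = (\<Sum>\<beta>\<in>A. b \<beta> * inner_L2 \<mu> (\<Psi> \<alpha>) (\<Psi> \<beta>))"
      using inner_expansion_right[OF tensor_in_L2] by (subst inner_L2_commute)
    also have "\<dots> = (\<Sum>\<beta>\<in>A. if \<beta> = \<alpha> then b \<beta> else 0)"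
      using A \<alpha> by (intro sum.cong refl) (auto simp: tensor_inner subset_iff)
    finally show ?thesis using A \<alpha> by simp
  qed
  then show ?thesis
    by (simp add: inner_expansion_right[OF expansion_in_L2] power2_eq_square)
qed

lemma expansion_dist:
  assumes f: "in_L2 \<mu> f" and A: "A \<subseteq> multi_indices d" "finite A"
  shows "(norm_L2 \<mu> (\<lambda>x. f x - expansion A b x))\<^sup>2
    = inner_L2 \<mu> f f - 2 * (\<Sum>\<alpha>\<in>A. b \<alpha> * inner_L2 \<mu> f (\<Psi> \<alpha>)) + (\<Sum>\<alpha>\<in>A. (b \<alpha>)\<^sup>2)"
  by (simp add: norm_L2_power2 inner_L2_diff_self[OF f expansion_in_L2]
      inner_expansion_right[OF f] norm_expansion[OF A])

lemma projection_is_expansion: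
  assumes f: "in_L2 \<mu> f" and A: "A \<subseteq> multi_indices d" "finite A"
    and proj: "is_orthogonal_projection \<mu> (regressor_span d \<psi> A) f g"
  shows "g = expansion A (\<lambda>\<alpha>. inner_L2 \<mu> f (\<Psi> \<alpha>))"
proof -
  obtain c where g: "g = expansion A c"
    using proj by (auto simp: is_orthogonal_projection_def regressor_span_def)
  have "c \<alpha> = inner_L2 \<mu> f (\<Psi> \<alpha>)" if \<alpha>: "\<alpha> \<in> A" for \<alpha>
  proof -
    have delta: "\<Psi> \<alpha> = expansion A (\<lambda>\<beta>. if \<beta> = \<alpha> then 1 else 0)"
      using \<alpha> A by (simp add: if_distrib[of "\<lambda>u. u * _"] cong: if_cong)
    then have "\<Psi> \<alpha> \<in> regressor_span d \<psi> A"
      unfolding regressor_span_def by (intro CollectI exI)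
    then have "inner_L2 \<mu> (\<lambda>x. f x - g x) (\<Psi> \<alpha>) = 0"
      using proj by (simp add: is_orthogonal_projection_def)
    then have "inner_L2 \<mu> f (\<Psi> \<alpha>) = inner_L2 \<mu> (\<Psi> \<alpha>) (expansion A c)"
      unfolding g inner_L2_diff_left[OF f expansion_in_L2 tensor_in_L2]
      by (simp add: inner_L2_commute)
    also have "\<dots> = (\<Sum>\<beta>\<in>A. if \<beta> = \<alpha> then c \<beta> else 0)"
      unfolding inner_expansion_right[OF tensor_in_L2]
      using A \<alpha> by (intro sum.cong refl) (auto simp: tensor_inner subset_iff)
    finally show ?thesis using A \<alpha> by simp
  qed
  then show ?thesis by (simp add: g)
qed

text \<open>Pythagoras: the projection error and the coefficient errors are orthogonal.\<close>

lemma expansion_dist_projection: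
  assumes f: "in_L2 \<mu> f" and A: "A \<subseteq> multi_indices d" "finite A"
    and proj: "is_orthogonal_projection \<mu> (regressor_span d \<psi> A) f g"
  shows "(norm_L2 \<mu> (\<lambda>x. f x - expansion A b x))\<^sup>2
    = (norm_L2 \<mu> (\<lambda>x. f x - g x))\<^sup>2 + (\<Sum>\<alpha>\<in>A. (b \<alpha> - inner_L2 \<mu> f (\<Psi> \<alpha>))\<^sup>2)"
  unfolding projection_is_expansion[OF assms] expansion_dist[OF f A]
  by (simp add: power2_diff sum.distrib sum_subtractf sum_distrib_left mult.assoc
      power2_eq_square[of "inner_L2 \<mu> f _", symmetric])

text \<open>
  Averaging over a coordinate \<open>i\<close> in the support of \<open>\<alpha>\<close> kills \<open>\<Psi> \<alpha>\<close>, because its factor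
  \<open>\<psi> i (\<alpha> i)\<close> is orthogonal to \<open>\<psi> i 0 = 1\<close>.
\<close>

lemma sobol_decomposition_expansion:
  assumes A: "finite A"
  shows "sobol_decomposition d M (expansion A c) (expansion_component d \<psi> A c)"
  unfolding sobol_decomposition_def
proof (intro conjI allI impI ballI)
  fix U assume U: "U \<subseteq> {1..d}"
  show "in_L2 (PiM U M) (expansion_component d \<psi> A c U)"
    unfolding expansion_component_def[abs_def]
    by (intro in_L2_sum in_L2_cmult psi_prod_in_L2 U)
  have fin: "finite U" using U by (rule finite_subset) simp
  show "AE z in PiM (U - {i}) M. (\<integral>t. expansion_component d \<psi> A c U (z(i := t)) \<partial>M i) = 0"
    if i: "i \<in> U" for i
  proof (rule AE_I2)
    fix z :: "nat \<Rightarrow> real"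
    have id: "i \<in> {1..d}" using i U by blast
    have prod: "(\<Prod>j\<in>U. \<psi> j (\<alpha> j) ((z(i := t)) j)) = (\<Prod>j\<in>U - {i}. \<psi> j (\<alpha> j) (z j)) * \<psi> i (\<alpha> i) t"
      for \<alpha> t
      unfolding prod.remove[OF fin i] by (simp add: mult.commute)
    have int: "integrable (M i) (\<psi> i k)" for k
      by (rule M.in_L2_integrable[OF psi_in_L2[OF id]])
    have "(\<integral>t. expansion_component d \<psi> A c U (z(i := t)) \<partial>M i)
        = (\<Sum>\<alpha>\<in>{\<alpha>\<in>A. index_support d \<alpha> = U}.
            c \<alpha> * ((\<Prod>j\<in>U - {i}. \<psi> j (\<alpha> j) (z j)) * (\<integral>t. \<psi> i (\<alpha> i) t \<partial>M i)))"
      unfolding expansion_component_def prod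
      by (subst Bochner_Integration.integral_sum) (simp_all add: int)
    also have "\<dots> = 0"
      using i by (intro sum.neutral ballI) (auto simp: psi_integral[OF id] index_support_def)
    finally show "(\<integral>t. expansion_component d \<psi> A c U (z(i := t)) \<partial>M i) = 0" .
  qed
next
  show "AE x in \<mu>. expansion A c x = (\<Sum>U\<in>Pow {1..d}. lift (expansion_component d \<psi> A c) U x)"
  proof (rule AE_I2)
    fix x assume x: "x \<in> space \<mu>"
    have "lift (expansion_component d \<psi> A c) U x
        = (\<Sum>\<alpha>\<in>{\<alpha>\<in>A. index_support d \<alpha> = U}. c \<alpha> * \<Psi> \<alpha> x)" for U
      unfolding expansion_component_def
      by (intro sum.cong refl) (auto simp: tensor_eq_prod_support[OF x] intro!: prod.cong)
    then have "(\<Sum>U\<in>Pow {1..d}. lift (expansion_component d \<psi> A c) U x)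
        = (\<Sum>U\<in>Pow {1..d}. \<Sum>\<alpha>\<in>{\<alpha>\<in>A. index_support d \<alpha> = U}. c \<alpha> * \<Psi> \<alpha> x)" by simp
    also have "\<dots> = expansion A c x"
      using A by (intro sum.group) (auto simp: index_support_def)
    finally show "expansion A c x = (\<Sum>U\<in>Pow {1..d}. lift (expansion_component d \<psi> A c) U x)" by simp
  qed
next
  fix z :: "nat \<Rightarrow> real"
  have "mean \<mu> (expansion A c) = (\<Sum>\<alpha>\<in>A. c \<alpha> * mean \<mu> (\<Psi> \<alpha>))"
    unfolding mean_def using P.in_L2_integrable[OF tensor_in_L2]
    by (subst Bochner_Integration.integral_sum) simp_all
  also have "\<dots> = (\<Sum>\<alpha>\<in>{\<alpha>\<in>A. index_support d \<alpha> = {}}. c \<alpha>)"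
    unfolding tensor_mean using A by (simp add: sum.If_cases if_distrib Int_def cong: if_cong)
  finally show "expansion_component d \<psi> A c {} z = mean \<mu> (expansion A c)"
    by (simp add: expansion_component_def)
qed

lemma component_var_expansion:
  assumes A: "A \<subseteq> multi_indices d" "finite A"
  shows "component_var d M (expansion_component d \<psi> A c) U
    = (if U = {} then 0 else \<Sum>\<alpha>\<in>{\<alpha>\<in>A. index_support d \<alpha> = U}. (c \<alpha>)\<^sup>2)"
proof -
  let ?B = "{\<alpha>\<in>A. index_support d \<alpha> = U}"
  have eq: "lift (expansion_component d \<psi> A c) U x = expansion ?B c x" if x: "x \<in> space \<mu>" for x
    unfolding expansion_component_def
    by (intro sum.cong refl) (auto simp: tensor_eq_prod_support[OF x] intro!: prod.cong)
  have "inner_L2 \<mu> (lift (expansion_component d \<psi> A c) U) (lift (expansion_component d \<psi> A c) U)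
      = inner_L2 \<mu> (expansion ?B c) (expansion ?B c)"
    unfolding inner_L2_def by (intro Bochner_Integration.integral_cong refl) (simp only: eq)
  also have "\<dots> = (\<Sum>\<alpha>\<in>?B. (c \<alpha>)\<^sup>2)"
    using A by (intro norm_expansion) auto
  finally show ?thesis by (simp add: component_var_def)
qed

end

section \<open>Mean square error of the empirical coefficients\<close>

text \<open>
  The mean of a product of functions of two independent variables factorises, also when the
  variables have different value types.
\<close>

lemma (in prob_space) independent_rvs_integral:
  fixes u :: "'b \<Rightarrow> real" and v :: "'c \<Rightarrow> real"
  assumes ind: "independent_rvs M A X B Y"
    and u: "u \<in> borel_measurable A" and v: "v \<in> borel_measurable B"
    and int: "integrable M (\<lambda>\<omega>. u (X \<omega>))" "integrable M (\<lambda>\<omega>. v (Y \<omega>))"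
  shows "integrable M (\<lambda>\<omega>. u (X \<omega>) * v (Y \<omega>))"
    and "(\<integral>\<omega>. u (X \<omega>) * v (Y \<omega>) \<partial>M) = (\<integral>\<omega>. u (X \<omega>) \<partial>M) * (\<integral>\<omega>. v (Y \<omega>) \<partial>M)"
proof -
  have X: "X \<in> measurable M A" and Y: "Y \<in> measurable M B"
    and sets: "indep_set {X -` S \<inter> space M | S. S \<in> sets A} {Y -` S \<inter> space M | S. S \<in> sets B}"
    using ind by (auto simp: independent_rvs_def)
  have pull: "{(\<lambda>\<omega>. g (Z \<omega>)) -` S \<inter> space M | S. S \<in> sets borel} \<subseteq> {Z -` S \<inter> space M | S. S \<in> sets C}"
    if Z: "Z \<in> measurable M C" and g: "g \<in> borel_measurable C" for Z :: "'a \<Rightarrow> 'd" and g :: "'d \<Rightarrow> real" and C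
  proof safe
    fix S :: "real set" assume S: "S \<in> sets borel"
    have "(\<lambda>\<omega>. g (Z \<omega>)) -` S \<inter> space M = Z -` (g -` S \<inter> space C) \<inter> space M"
      using measurable_space[OF Z] by auto
    then show "\<exists>S'. (\<lambda>\<omega>. g (Z \<omega>)) -` S \<inter> space M = Z -` S' \<inter> space M \<and> S' \<in> sets C"
      using measurable_sets[OF g S] by blast
  qed
  have stable: "Int_stable {g -` S \<inter> space M | S. S \<in> sets (borel :: real measure)}" for g :: "'a \<Rightarrow> real"
  proof (rule Int_stableI)
    fix a b assume "a \<in> {g -` S \<inter> space M | S. S \<in> sets borel}" "b \<in> {g -` S \<inter> space M | S. S \<in> sets borel}"
    then obtain S T where "S \<in> sets borel" "T \<in> sets borel" "a \<inter> b = g -` (S \<inter> T) \<inter> space M" by auto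
    then show "a \<inter> b \<in> {g -` S \<inter> space M | S. S \<in> sets borel}" by blast
  qed
  have "indep_set {(\<lambda>\<omega>. u (X \<omega>)) -` S \<inter> space M | S. S \<in> sets borel}
      {(\<lambda>\<omega>. v (Y \<omega>)) -` S \<inter> space M | S. S \<in> sets borel}"
    using sets pull[OF X u] pull[OF Y v] unfolding indep_set_def
    by (elim indep_sets_mono_sets) (auto split: bool.split)
  then have "indep_var borel (\<lambda>\<omega>. u (X \<omega>)) borel (\<lambda>\<omega>. v (Y \<omega>))"
    unfolding indep_var_eq
    using measurable_compose[OF X u] measurable_compose[OF Y v] indep_set_sigma_sets[OF _ stable stable]
    by auto
  then show "integrable M (\<lambda>\<omega>. u (X \<omega>) * v (Y \<omega>))"
    and "(\<integral>\<omega>. u (X \<omega>) * v (Y \<omega>) \<partial>M) = (\<integral>\<omega>. u (X \<omega>) \<partial>M) * (\<integral>\<omega>. v (Y \<omega>) \<partial>M)"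
    using int by (auto intro: indep_var_integrable indep_var_lebesgue_integral)
qed

lemma (in prob_space) indep_vars_pair_integral:
  fixes u v :: "'b \<Rightarrow> real"
  assumes ind: "indep_vars (\<lambda>_. Q) X I" and ij: "i \<in> I" "j \<in> I" "i \<noteq> j"
    and u: "u \<in> borel_measurable Q" and v: "v \<in> borel_measurable Q"
    and int: "integrable M (\<lambda>\<omega>. u (X i \<omega>))" "integrable M (\<lambda>\<omega>. v (X j \<omega>))"
  shows "(\<integral>\<omega>. u (X i \<omega>) * v (X j \<omega>) \<partial>M) = (\<integral>\<omega>. u (X i \<omega>) \<partial>M) * (\<integral>\<omega>. v (X j \<omega>) \<partial>M)"
proof -
  have "indep_vars (\<lambda>_. Q) X {i, j}"
    using ij by (intro indep_vars_subset[OF ind]) auto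
  then have "indep_vars (\<lambda>_. borel) (\<lambda>l \<omega>. (if l = i then u else v) (X l \<omega>)) {i, j}"
    by (rule indep_vars_compose2[where Y = "\<lambda>l. if l = i then u else v"]) (simp add: u v)
  from indep_vars_sum[OF _ _ this] ij(3)
  have "indep_var borel (\<lambda>\<omega>. u (X i \<omega>)) borel (\<lambda>\<omega>. v (X j \<omega>))" by simp
  then show ?thesis using int by (rule indep_var_lebesgue_integral)
qed

text \<open>A mean of \<open>n\<close> pairwise orthogonal errors of equal second moment \<open>s\<close> has second moment \<open>s / n\<close>.\<close>

lemma mean_orthogonal_errors:
  fixes D :: "nat \<Rightarrow> 'w \<Rightarrow> real"
  assumes n: "n \<ge> 1"
    and int: "\<And>i j. i \<in> {1..n} \<Longrightarrow> j \<in> {1..n} \<Longrightarrow> integrable P (\<lambda>\<omega>. D i \<omega> * D j \<omega>)"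
    and orth: "\<And>i j. i \<in> {1..n} \<Longrightarrow> j \<in> {1..n} \<Longrightarrow> (\<integral>\<omega>. D i \<omega> * D j \<omega> \<partial>P) = (if i = j then s else 0)"
  shows "integrable P (\<lambda>\<omega>. (1 / real n * (\<Sum>i=1..n. D i \<omega>))\<^sup>2)"
    and "(\<integral>\<omega>. (1 / real n * (\<Sum>i=1..n. D i \<omega>))\<^sup>2 \<partial>P) = s / real n"
proof -
  have expand: "(1 / real n * (\<Sum>i=1..n. D i \<omega>))\<^sup>2
      = (1 / real n)\<^sup>2 * (\<Sum>i=1..n. \<Sum>j=1..n. D i \<omega> * D j \<omega>)" for \<omega>
    by (simp only: power_mult_distrib power2_eq_square[of "sum _ _"] sum_product)
  show "integrable P (\<lambda>\<omega>. (1 / real n * (\<Sum>i=1..n. D i \<omega>))\<^sup>2)"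
    unfolding expand by (intro integrable_mult_right Bochner_Integration.integrable_sum int)
  have "(\<integral>\<omega>. (1 / real n * (\<Sum>i=1..n. D i \<omega>))\<^sup>2 \<partial>P)
      = (1 / real n)\<^sup>2 * (\<Sum>i=1..n. \<Sum>j=1..n. \<integral>\<omega>. D i \<omega> * D j \<omega> \<partial>P)"
    unfolding expand using int
    by (subst integral_mult_right_zero, subst Bochner_Integration.integral_sum)
      (auto simp del: atLeastAtMost_iff intro!: sum.cong Bochner_Integration.integral_sum)
  also have "\<dots> = (1 / real n)\<^sup>2 * (\<Sum>i=1..n. \<Sum>j=1..n. if i = j then s else 0)"
    by (intro arg_cong2[where f = "(*)"] sum.cong refl orth)
  also have "\<dots> = s / real n"
    using n by (simp add: power2_eq_square)
  finally show "(\<integral>\<omega>. (1 / real n * (\<Sum>i=1..n. D i \<omega>))\<^sup>2 \<partial>P) = s / real n" .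
qed

lemma in_L2_distr:
  assumes X: "X \<in> measurable P Q" "distr P Q X = Q" and g: "in_L2 Q g"
  shows "in_L2 P (\<lambda>\<omega>. g (X \<omega>))"
proof -
  have [measurable]: "g \<in> borel_measurable Q" using g by (simp add: in_L2_def)
  have "integrable (distr P Q X) (\<lambda>x. (g x)\<^sup>2)" using X g by (simp add: in_L2_def)
  then show ?thesis
    using X(1) by (simp add: in_L2_def integrable_distr_eq)
qed

text \<open>
  With noisy observations \<open>f (X i) + \<eta> i\<close> of a bounded function, the error of the empirical
  coefficient along a unit vector \<open>k\<close> is the mean of the errors
  \<open>(f k) (X i) - \<langle>f, k\<rangle> + \<eta> i k (X i)\<close>, which are centred and pairwise orthogonal.
\<close>

lemma empirical_coefficient_error:
  fixes f k :: "'a \<Rightarrow> real" and X :: "nat \<Rightarrow> 'w \<Rightarrow> 'a" and \<eta> :: "nat \<Rightarrow> 'w \<Rightarrow> real"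
  assumes P: "prob_space P" and Q: "prob_space Q" and n: "n \<ge> 1"
    and X_indep: "prob_space.indep_vars P (\<lambda>_. Q) X {1..n}"
    and X_distr: "\<And>i. i \<in> {1..n} \<Longrightarrow> distr P Q (X i) = Q"
    and eta_indep: "prob_space.indep_vars P (\<lambda>_. borel) \<eta> {1..n}"
    and eta_L2: "\<And>i. i \<in> {1..n} \<Longrightarrow> in_L2 P (\<eta> i)"
    and eta_mean: "\<And>i. i \<in> {1..n} \<Longrightarrow> mean P (\<eta> i) = 0"
    and eta_var: "\<And>i. i \<in> {1..n} \<Longrightarrow> var P (\<eta> i) = \<sigma>\<^sup>2"
    and X_eta: "independent_rvs P (PiM {1..n} (\<lambda>_. Q)) (\<lambda>\<omega>. \<lambda>i\<in>{1..n}. X i \<omega>)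
          (PiM {1..n} (\<lambda>_. borel)) (\<lambda>\<omega>. \<lambda>i\<in>{1..n}. \<eta> i \<omega>)"
    and f: "f \<in> borel_measurable Q" and f_bound: "\<And>x. x \<in> space Q \<Longrightarrow> \<bar>f x\<bar> \<le> L"
    and k: "in_L2 Q k" and k_norm: "inner_L2 Q k k = 1"
  defines "err \<equiv> \<lambda>\<omega>. 1 / real n * (\<Sum>i=1..n. (f (X i \<omega>) + \<eta> i \<omega>) * k (X i \<omega>)) - inner_L2 Q f k"
  shows "integrable P (\<lambda>\<omega>. (err \<omega>)\<^sup>2)" and "(\<integral>\<omega>. (err \<omega>)\<^sup>2 \<partial>P) \<le> (L\<^sup>2 + \<sigma>\<^sup>2) / real n"
proof -
  interpret P: prob_space P by fact
  interpret Q: prob_space Q by fact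
  define c where "c = inner_L2 Q f k"
  define a where "a x = f x * k x - c" for x
  define D where "D i \<omega> = a (X i \<omega>) + \<eta> i \<omega> * k (X i \<omega>)" for i \<omega>
  have [measurable]: "f \<in> borel_measurable Q" "k \<in> borel_measurable Q"
    using f k by (auto simp: in_L2_def)
  then have a_meas [measurable]: "a \<in> borel_measurable Q" unfolding a_def[abs_def] by measurable
  have X_meas: "X i \<in> measurable P Q" if "i \<in> {1..n}" for i
    using X_indep that by (auto simp: P.indep_vars_def)
  have fk2: "(f x * k x)\<^sup>2 \<le> L\<^sup>2 * (k x)\<^sup>2" if "x \<in> space Q" for x
    unfolding power_mult_distrib using power_mono[OF f_bound[OF that], of 2]
    by (intro mult_right_mono) auto
  have k2: "integrable Q (\<lambda>x. (k x)\<^sup>2)" using k by (simp add: in_L2_def)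
  have fk: "in_L2 Q (\<lambda>x. f x * k x)"
    unfolding in_L2_def
  proof
    show "integrable Q (\<lambda>x. (f x * k x)\<^sup>2)"
      by (rule Bochner_Integration.integrable_bound[OF integrable_mult_right[OF k2, of "L\<^sup>2"]])
        (use fk2 in \<open>auto intro!: AE_I2\<close>)
  qed measurable
  have a: "in_L2 Q a"
    unfolding a_def[abs_def] using fk by (rule in_L2_diff) (simp add: in_L2_def)
  have a_mean: "(\<integral>x. a x \<partial>Q) = 0"
    using Q.in_L2_integrable[OF fk] by (simp add: a_def c_def inner_L2_def Q.prob_space)
  have "(\<integral>x. (a x)\<^sup>2 \<partial>Q) = var Q (\<lambda>x. f x * k x)"
    by (simp add: var_def mean_def a_def c_def inner_L2_def)
  also have "\<dots> \<le> (\<integral>x. (f x * k x)\<^sup>2 \<partial>Q)"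
    unfolding Q.var_eq_inner_L2[OF fk] by (simp add: inner_L2_def power2_eq_square)
  also have "\<dots> \<le> (\<integral>x. L\<^sup>2 * (k x)\<^sup>2 \<partial>Q)"
    using fk k2 fk2 by (intro integral_mono) (auto simp: in_L2_def)
  also have "\<dots> = L\<^sup>2"
    using k_norm by (simp add: inner_L2_def power2_eq_square)
  finally have a_sq: "(\<integral>x. (a x)\<^sup>2 \<partial>Q) \<le> L\<^sup>2" .

  have transfer: "(\<integral>\<omega>. u (X i \<omega>) \<partial>P) = (\<integral>x. u x \<partial>Q)"
    if "u \<in> borel_measurable Q" "i \<in> {1..n}" for u :: "'a \<Rightarrow> real" and i
    using integral_distr[OF X_meas[OF that(2)] that(1)] X_distr[OF that(2)] by simp
  have aX: "in_L2 P (\<lambda>\<omega>. a (X i \<omega>))" and kX: "in_L2 P (\<lambda>\<omega>. k (X i \<omega>))" if "i \<in> {1..n}" for i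
    using that by (auto intro: in_L2_distr[OF X_meas X_distr] a k)
  note prod_int = in_L2_mult_integrable
  have eta_int: "integrable P (\<eta> i)" if "i \<in> {1..n}" for i
    using that by (intro P.in_L2_integrable eta_L2)
  have eta_eta: "(\<integral>\<omega>. \<eta> i \<omega> * \<eta> j \<omega> \<partial>P) = (if i = j then \<sigma>\<^sup>2 else 0)"
    if ij: "i \<in> {1..n}" "j \<in> {1..n}" for i j
  proof (cases "i = j")
    case True
    then show ?thesis
      using P.var_eq_inner_L2[OF eta_L2] eta_mean eta_var ij by (simp add: inner_L2_def)
  next
    case False
    then show ?thesis
      using P.indep_vars_pair_integral[OF eta_indep ij False, of "\<lambda>x. x" "\<lambda>x. x"] ij eta_int eta_mean
      by (simp add: mean_def)
  qed

  \<comment> \<open>A product of a function of the design with one of the noise factorises.\<close>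
  have cross_int: "integrable P (\<lambda>\<omega>. a (X i \<omega>) * k (X j \<omega>) * \<eta> j \<omega>)"
    and cross: "(\<integral>\<omega>. a (X i \<omega>) * k (X j \<omega>) * \<eta> j \<omega> \<partial>P) = 0"
    if ij: "i \<in> {1..n}" "j \<in> {1..n}" for i j
  proof -
    have u: "(\<lambda>x. a (x i) * k (x j)) \<in> borel_measurable (PiM {1..n} (\<lambda>_. Q))"
      and v: "(\<lambda>y. y j) \<in> borel_measurable (PiM {1..n} (\<lambda>_. borel :: real measure))"
      using ij by measurable
    note I = P.independent_rvs_integral[OF X_eta u v]
    show "integrable P (\<lambda>\<omega>. a (X i \<omega>) * k (X j \<omega>) * \<eta> j \<omega>)"
      using I(1) ij prod_int[OF aX[OF ij(1)] kX[OF ij(2)]] eta_int by simp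
    show "(\<integral>\<omega>. a (X i \<omega>) * k (X j \<omega>) * \<eta> j \<omega> \<partial>P) = 0"
      using I(2) ij prod_int[OF aX[OF ij(1)] kX[OF ij(2)]] eta_int eta_mean by (simp add: mean_def)
  qed
  have noise_int: "integrable P (\<lambda>\<omega>. k (X i \<omega>) * k (X j \<omega>) * (\<eta> i \<omega> * \<eta> j \<omega>))"
    and noise: "(\<integral>\<omega>. k (X i \<omega>) * k (X j \<omega>) * (\<eta> i \<omega> * \<eta> j \<omega>) \<partial>P) = (if i = j then \<sigma>\<^sup>2 else 0)"
    if ij: "i \<in> {1..n}" "j \<in> {1..n}" for i j
  proof -
    have u: "(\<lambda>x. k (x i) * k (x j)) \<in> borel_measurable (PiM {1..n} (\<lambda>_. Q))"
      and v: "(\<lambda>y. y i * y j) \<in> borel_measurable (PiM {1..n} (\<lambda>_. borel :: real measure))"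
      using ij by measurable
    note I = P.independent_rvs_integral[OF X_eta u v]
    note int = prod_int[OF kX[OF ij(1)] kX[OF ij(2)]] prod_int[OF eta_L2[OF ij(1)] eta_L2[OF ij(2)]]
    show "integrable P (\<lambda>\<omega>. k (X i \<omega>) * k (X j \<omega>) * (\<eta> i \<omega> * \<eta> j \<omega>))"
      using I(1) ij int by simp
    have "(\<integral>\<omega>. k (X i \<omega>) * k (X i \<omega>) \<partial>P) = 1"
      using transfer[of "\<lambda>x. k x * k x" i] ij k_norm by (simp add: inner_L2_def)
    then show "(\<integral>\<omega>. k (X i \<omega>) * k (X j \<omega>) * (\<eta> i \<omega> * \<eta> j \<omega>) \<partial>P) = (if i = j then \<sigma>\<^sup>2 else 0)"
      using I(2) ij int eta_eta[OF ij] by (cases "i = j") auto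
  qed
  have design: "(\<integral>\<omega>. a (X i \<omega>) * a (X j \<omega>) \<partial>P) = (if i = j then \<integral>x. (a x)\<^sup>2 \<partial>Q else 0)"
    if ij: "i \<in> {1..n}" "j \<in> {1..n}" for i j
  proof (cases "i = j")
    case True
    then show ?thesis
      using transfer[of "\<lambda>x. (a x)\<^sup>2" i] ij by (simp add: power2_eq_square)
  next
    case False
    have "(\<integral>\<omega>. a (X i \<omega>) * a (X j \<omega>) \<partial>P) = (\<integral>\<omega>. a (X i \<omega>) \<partial>P) * (\<integral>\<omega>. a (X j \<omega>) \<partial>P)"
      using aX ij by (intro P.indep_vars_pair_integral[OF X_indep ij False a_meas a_meas]
          P.in_L2_integrable)
    then show ?thesis using transfer[OF a_meas] ij a_mean False by simp
  qed

  have D_prod: "D i \<omega> * D j \<omega> = a (X i \<omega>) * a (X j \<omega>) + a (X i \<omega>) * k (X j \<omega>) * \<eta> j \<omega>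
      + a (X j \<omega>) * k (X i \<omega>) * \<eta> i \<omega> + k (X i \<omega>) * k (X j \<omega>) * (\<eta> i \<omega> * \<eta> j \<omega>)" for i j \<omega>
    unfolding D_def by algebra
  have D_int: "integrable P (\<lambda>\<omega>. D i \<omega> * D j \<omega>)"
    and D_orth: "(\<integral>\<omega>. D i \<omega> * D j \<omega> \<partial>P) = (if i = j then (\<integral>x. (a x)\<^sup>2 \<partial>Q) + \<sigma>\<^sup>2 else 0)"
    if ij: "i \<in> {1..n}" "j \<in> {1..n}" for i j
    unfolding D_prod
    using prod_int[OF aX[OF ij(1)] aX[OF ij(2)]] cross_int[OF ij] cross_int[OF ij(2,1)] noise_int[OF ij]
      design[OF ij] cross[OF ij] cross[OF ij(2,1)] noise[OF ij]
    by auto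
  have err: "err \<omega> = 1 / real n * (\<Sum>i=1..n. D i \<omega>)" for \<omega>
  proof -
    have "(\<Sum>i=1..n. D i \<omega>) = (\<Sum>i=1..n. (f (X i \<omega>) + \<eta> i \<omega>) * k (X i \<omega>)) - real n * c"
      unfolding D_def a_def by (simp add: algebra_simps sum.distrib sum_subtractf)
    then show ?thesis using n by (simp add: err_def c_def right_diff_distrib)
  qed
  show "integrable P (\<lambda>\<omega>. (err \<omega>)\<^sup>2)"
    unfolding err by (rule mean_orthogonal_errors(1)[OF n D_int D_orth])
  have "(\<integral>\<omega>. (err \<omega>)\<^sup>2 \<partial>P) = ((\<integral>x. (a x)\<^sup>2 \<partial>Q) + \<sigma>\<^sup>2) / real n"
    unfolding err by (rule mean_orthogonal_errors(2)[OF n D_int D_orth])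
  also have "\<dots> \<le> (L\<^sup>2 + \<sigma>\<^sup>2) / real n"
    using a_sq by (intro divide_right_mono) auto
  finally show "(\<integral>\<omega>. (err \<omega>)\<^sup>2 \<partial>P) \<le> (L\<^sup>2 + \<sigma>\<^sup>2) / real n" .
qed

section \<open>Expected index errors\<close>

lemma (in tensor_basis) share_expansion_measurable:
  assumes A: "A \<subseteq> multi_indices d" "finite A"
    and c: "\<And>\<alpha>. \<alpha> \<in> A \<Longrightarrow> (\<lambda>\<omega>. c \<omega> \<alpha>) \<in> borel_measurable P"
  shows "(\<lambda>\<omega>. if var \<mu> (expansion A (c \<omega>)) = 0 then b
      else (\<Sum>W\<in>T. component_var d M (expansion_component d \<psi> A (c \<omega>)) W) / var \<mu> (expansion A (c \<omega>)))
    \<in> borel_measurable P"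
proof -
  have comp [measurable]:
    "(\<lambda>\<omega>. component_var d M (expansion_component d \<psi> A (c \<omega>)) W) \<in> borel_measurable P" for W
    unfolding component_var_expansion[OF A]
    by (cases "W = {}") (auto intro!: borel_measurable_sum borel_measurable_power c)
  have var: "var \<mu> (expansion A (c \<omega>))
      = (\<Sum>W\<in>Pow {1..d}. component_var d M (expansion_component d \<psi> A (c \<omega>)) W)" for \<omega>
    by (rule var_eq_sum_component_var[OF expansion_in_L2 sobol_decomposition_expansion[OF A(2)]])
  show ?thesis unfolding var by measurable
qed

lemma (in prob_space) integral_sqrt_le:
  assumes e: "integrable M e" and nonneg: "\<And>\<omega>. 0 \<le> e \<omega>"
  shows "integrable M (\<lambda>\<omega>. sqrt (e \<omega>))" and "(\<integral>\<omega>. sqrt (e \<omega>) \<partial>M) \<le> sqrt (\<integral>\<omega>. e \<omega> \<partial>M)"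
proof -
  have L2: "in_L2 M (\<lambda>\<omega>. sqrt (e \<omega>))"
    using e nonneg by (simp add: in_L2_def borel_measurable_integrable)
  then show "integrable M (\<lambda>\<omega>. sqrt (e \<omega>))" by (rule in_L2_integrable)
  have "in_L2 M (\<lambda>_. 1)" by (simp add: in_L2_def)
  from inner_L2_Cauchy_Schwarz[OF L2 this]
  show "(\<integral>\<omega>. sqrt (e \<omega>) \<partial>M) \<le> sqrt (\<integral>\<omega>. e \<omega> \<partial>M)"
    using nonneg by (simp add: inner_L2_def norm_L2_def prob_space)
qed

text \<open>The indices depend only on the factors with index in \<open>{1..d}\<close>.\<close>

lemma sobol_index_cong:
  assumes "\<And>i. i \<in> {1..d} \<Longrightarrow> M i = M' i"
  shows "sobol_index d M = sobol_index d M'" "total_effect_index d M = total_effect_index d M'"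
proof -
  have PiM: "PiM U M = PiM U M'" if "U \<subseteq> {1..d}" for U
    using that assms by (intro PiM_cong) auto
  have "sobol_decomposition d M f F = sobol_decomposition d M' f F" for f F
  proof -
    have "(\<forall>U\<subseteq>{1..d}. in_L2 (PiM U M) (F U)) \<longleftrightarrow> (\<forall>U\<subseteq>{1..d}. in_L2 (PiM U M') (F U))"
      using PiM by auto
    moreover have "(\<forall>U\<subseteq>{1..d}. \<forall>i\<in>U. AE z in PiM (U - {i}) M. (\<integral>t. F U (z(i := t)) \<partial>M i) = 0)
        \<longleftrightarrow> (\<forall>U\<subseteq>{1..d}. \<forall>i\<in>U. AE z in PiM (U - {i}) M'. (\<integral>t. F U (z(i := t)) \<partial>M' i) = 0)"
    proof (intro all_cong ball_cong refl)
      fix U i assume "U \<subseteq> {1..d}" "i \<in> U"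
      then have "PiM (U - {i}) M = PiM (U - {i}) M'" "M i = M' i"
        using assms by (auto intro!: PiM)
      then show "(AE z in PiM (U - {i}) M. (\<integral>t. F U (z(i := t)) \<partial>M i) = 0)
        \<longleftrightarrow> (AE z in PiM (U - {i}) M'. (\<integral>t. F U (z(i := t)) \<partial>M' i) = 0)" by (simp only:)
    qed
    ultimately show ?thesis
      unfolding sobol_decomposition_def PiM[OF subset_refl] PiM[OF empty_subsetI] by blast
  qed
  then have "sobol_decomposition d M = sobol_decomposition d M'" by blast
  then show "sobol_index d M = sobol_index d M'"
    by (intro ext) (simp only: sobol_index_def sobol_component_def PiM[OF subset_refl])
  then show "total_effect_index d M = total_effect_index d M'"
    by (intro ext) (simp only: total_effect_index_def PiM[OF subset_refl])
qed

theorem theorem5: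
  fixes d n N :: nat
    and M :: "nat \<Rightarrow> real measure"
    and f fN :: "(nat \<Rightarrow> real) \<Rightarrow> real"
    and L \<sigma> Rp :: real
    and \<psi> :: "nat \<Rightarrow> nat \<Rightarrow> real \<Rightarrow> real"
    and \<Lambda> :: "nat \<Rightarrow> (nat \<Rightarrow> nat) set"
    and P :: "'w measure"
    and X :: "nat \<Rightarrow> 'w \<Rightarrow> (nat \<Rightarrow> real)"
    and \<eta> :: "nat \<Rightarrow> 'w \<Rightarrow> real"
    and index :: "((nat \<Rightarrow> real) \<Rightarrow> real) \<Rightarrow> nat set \<Rightarrow> real"
    and fhat :: "'w \<Rightarrow> (nat \<Rightarrow> real) \<Rightarrow> real"
  assumes M_prob: "\<And>i. i \<in> {1..d} \<Longrightarrow> prob_space (M i)"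
    and M_sets: "\<And>i. i \<in> {1..d} \<Longrightarrow> sets (M i) = sets (restrict_space borel (space (M i)))"
    and f_L2: "in_L2 (prod_measure d M) f"
    and f_var: "var (prod_measure d M) f > 0"
    and f_bound: "\<And>x. x \<in> space (prod_measure d M) \<Longrightarrow> \<bar>f x\<bar> \<le> L"
    and psi_orth: "\<And>i. i \<in> {1..d} \<Longrightarrow> orthonormal_family (M i) (\<psi> i)"
    and psi_zero: "\<And>i t. i \<in> {1..d} \<Longrightarrow> t \<in> space (M i) \<Longrightarrow> \<psi> i 0 t = 1"
    and Lambda_1: "\<Lambda> 1 = {zero_index d}"
    and Lambda_nested: "\<And>k. k \<ge> 1 \<Longrightarrow> \<Lambda> k \<subset> \<Lambda> (Suc k)"
    and Lambda_multi: "\<And>k. k \<ge> 1 \<Longrightarrow> \<Lambda> k \<subseteq> multi_indices d"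
    and Lambda_card: "\<And>k. k \<ge> 1 \<Longrightarrow> card (\<Lambda> k) = k"
    and N_pos: "N \<ge> 1"
    and n_pos: "n \<ge> 1"
    and fN_proj: "is_orthogonal_projection (prod_measure d M) (regressor_span d \<psi> (\<Lambda> N)) f fN"
    and P_prob: "prob_space P"
    and X_indep: "prob_space.indep_vars P (\<lambda>_. prod_measure d M) X {1..n}"
    and X_distr: "\<And>i. i \<in> {1..n} \<Longrightarrow> distr P (prod_measure d M) (X i) = prod_measure d M"
    and eta_indep: "prob_space.indep_vars P (\<lambda>_. borel) \<eta> {1..n}"
    and eta_ident: "\<And>i j. i \<in> {1..n} \<Longrightarrow> j \<in> {1..n} \<Longrightarrow> distr P borel (\<eta> i) = distr P borel (\<eta> j)"
    and eta_L2: "\<And>i. i \<in> {1..n} \<Longrightarrow> in_L2 P (\<eta> i)"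
    and eta_mean: "\<And>i. i \<in> {1..n} \<Longrightarrow> mean P (\<eta> i) = 0"
    and eta_var: "\<And>i. i \<in> {1..n} \<Longrightarrow> var P (\<eta> i) = \<sigma>\<^sup>2"
    and X_eta_indep: "independent_rvs P
          (PiM {1..n} (\<lambda>_. prod_measure d M)) (\<lambda>\<omega>. \<lambda>i\<in>{1..n}. X i \<omega>)
          (PiM {1..n} (\<lambda>_. borel)) (\<lambda>\<omega>. \<lambda>i\<in>{1..n}. \<eta> i \<omega>)"
    and fhat: "\<And>\<omega>. fhat \<omega> = projection_approx d \<psi> (\<Lambda> N) n
                        (\<lambda>i. X i \<omega>) (\<lambda>i. f (X i \<omega>) + \<eta> i \<omega>)"
    and Rp_nonneg: "Rp \<ge> 0"
    and Rp_sq: "Rp\<^sup>2 = 1 / var (prod_measure d M) f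
                        * (norm_L2 (prod_measure d M) (\<lambda>x. f x - fN x))\<^sup>2
                      + (L\<^sup>2 + \<sigma>\<^sup>2) / var (prod_measure d M) f * (real N / real n)"
    and index_cases: "index = sobol_index d M \<or> index = total_effect_index d M"
  shows "(\<forall>U\<in>Pow {1..d}. integrable P (\<lambda>\<omega>. (index f U - index (fhat \<omega>) U)\<^sup>2)
            \<and> integrable P (\<lambda>\<omega>. \<bar>index f U - index (fhat \<omega>) U\<bar>))
       \<and> (MAX U\<in>Pow {1..d}. \<integral>\<omega>. (index f U - index (fhat \<omega>) U)\<^sup>2 \<partial>P) \<le> Rp\<^sup>2
       \<and> (\<forall>U\<in>Pow {1..d}. (\<integral>\<omega>. \<bar>index f U - index (fhat \<omega>) U\<bar> \<partial>P)
            \<le> Rp * (Rp + 2 * sqrt (index f U)))"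
proof -
  \<comment> \<open>Outside \<open>{1..d}\<close> nothing is known of \<open>M\<close>; there it is replaced by a point mass.\<close>
  define M' where "M' = (\<lambda>i. if i \<in> {1..d} then M i else return borel 0)"
  have M': "M' i = M i" if "i \<in> {1..d}" for i using that by (simp add: M'_def)
  have prod_M: "prod_measure d M = prod_measure d M'"
    by (rule PiM_cong) (simp_all add: M')
  have index: "index = sobol_index d M' \<or> index = total_effect_index d M'"
    using index_cases sobol_index_cong[of d M M'] M' by auto
  have "prob_space (M' i)" for i
    using M_prob by (auto simp: M'_def intro: prob_space_return)
  then have prob_M': "product_prob_space M'"
    by (rule product_prob_spaceI)
  interpret tensor_basis d M' \<psi>
  proof (intro tensor_basis.intro product_input.intro tensor_basis_axioms.intro prob_M')
    fix i :: nat and t assume i: "i \<in> {1..d}"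
    show "orthonormal_family (M' i) (\<psi> i)" using psi_orth[OF i] by (simp only: M'[OF i])
    show "\<psi> i 0 t = 1" if "t \<in> space (M' i)" using psi_zero[OF i] that by (simp only: M'[OF i])
  qed
  note [simp] = prod_M
  interpret W: prob_space P by (fact P_prob)
  define A where "A = \<Lambda> N"
  have A: "A \<subseteq> multi_indices d" "finite A" and card_A: "card A = N"
    using Lambda_multi[OF N_pos] Lambda_card[OF N_pos] N_pos
    by (auto simp: A_def intro: card_ge_0_finite)
  let ?V = "var \<mu> f"
  have f: "in_L2 \<mu> f" and V: "?V > 0" and B: "\<And>x. x \<in> space \<mu> \<Longrightarrow> \<bar>f x\<bar> \<le> L"
    and proj: "is_orthogonal_projection \<mu> (regressor_span d \<psi> A) f fN"
    using f_L2 f_var f_bound fN_proj by (simp_all add: A_def)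
  have f_meas [measurable]: "f \<in> borel_measurable \<mu>" using f by (simp add: in_L2_def)
  have F: "sobol_decomposition d M' f (moebius_component f)"
    by (rule sobol_decomposition_bounded[OF f_meas B])
  define ch where "ch \<omega> = projection_coeff d \<psi> n (\<lambda>i. X i \<omega>) (\<lambda>i. f (X i \<omega>) + \<eta> i \<omega>)" for \<omega>
  have fhat_eq: "fhat \<omega> = expansion A (ch \<omega>)" for \<omega>
    by (simp add: fhat projection_approx_def fun_eq_iff ch_def A_def)
  have G: "sobol_decomposition d M' (fhat \<omega>) (expansion_component d \<psi> A (ch \<omega>))" for \<omega>
    unfolding fhat_eq by (rule sobol_decomposition_expansion[OF A(2)])
  have fhat_L2: "in_L2 \<mu> (fhat \<omega>)" for \<omega> unfolding fhat_eq by (rule expansion_in_L2)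

  have ch_meas: "(\<lambda>\<omega>. ch \<omega> \<alpha>) \<in> borel_measurable P" for \<alpha>
  proof -
    have summand: "(\<lambda>\<omega>. (f (X i \<omega>) + \<eta> i \<omega>) * \<Psi> \<alpha> (X i \<omega>)) \<in> borel_measurable P" if i: "i \<in> {1..n}" for i
    proof -
      have X: "X i \<in> measurable P \<mu>" using X_indep i by (auto simp: W.indep_vars_def)
      have \<Psi>: "\<Psi> \<alpha> \<in> borel_measurable \<mu>" and \<eta>: "\<eta> i \<in> borel_measurable P"
        using tensor_in_L2 eta_L2[OF i] by (simp_all add: in_L2_def)
      show ?thesis
        by (intro borel_measurable_times borel_measurable_add
            measurable_compose[OF X f_meas] measurable_compose[OF X \<Psi>] \<eta>)
    qed
    show ?thesis
      unfolding ch_def projection_coeff_def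
      by (rule borel_measurable_times[OF borel_measurable_const borel_measurable_sum[OF summand]])
  qed

  define err where "err \<alpha> \<omega> = (ch \<omega> \<alpha> - inner_L2 \<mu> f (\<Psi> \<alpha>))\<^sup>2" for \<alpha> \<omega>
  have err_int: "integrable P (err \<alpha>)" and err_le: "(\<integral>\<omega>. err \<alpha> \<omega> \<partial>P) \<le> (L\<^sup>2 + \<sigma>\<^sup>2) / real n"
    if \<alpha>: "\<alpha> \<in> A" for \<alpha>
  proof -
    have "inner_L2 \<mu> (\<Psi> \<alpha>) (\<Psi> \<alpha>) = 1" using tensor_inner \<alpha> A by auto
    note E = empirical_coefficient_error[OF P_prob P.prob_space_axioms n_pos _ _ eta_indep eta_L2 eta_mean eta_var
        _ f_meas B tensor_in_L2 this]
    show "integrable P (err \<alpha>)" "(\<integral>\<omega>. err \<alpha> \<omega> \<partial>P) \<le> (L\<^sup>2 + \<sigma>\<^sup>2) / real n"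
      using E X_indep X_distr X_eta_indep unfolding err_def[abs_def] ch_def projection_coeff_def by simp_all
  qed

  define e where "e \<omega> = (norm_L2 \<mu> (\<lambda>x. f x - fhat \<omega> x))\<^sup>2 / ?V" for \<omega>
  have e_eq: "e \<omega> = ((norm_L2 \<mu> (\<lambda>x. f x - fN x))\<^sup>2 + (\<Sum>\<alpha>\<in>A. err \<alpha> \<omega>)) / ?V" for \<omega>
    unfolding e_def fhat_eq expansion_dist_projection[OF f A proj] err_def ..
  have e_nonneg: "0 \<le> e \<omega>" for \<omega> using V by (simp add: e_def)
  have e_int: "integrable P e"
    unfolding e_eq[abs_def] using err_int by auto
  have e_le: "(\<integral>\<omega>. e \<omega> \<partial>P) \<le> Rp\<^sup>2"
  proof -
    have "(\<integral>\<omega>. e \<omega> \<partial>P) = ((norm_L2 \<mu> (\<lambda>x. f x - fN x))\<^sup>2 + (\<Sum>\<alpha>\<in>A. \<integral>\<omega>. err \<alpha> \<omega> \<partial>P)) / ?V"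
      unfolding e_eq using err_int by (simp add: W.prob_space)
    also have "\<dots> \<le> ((norm_L2 \<mu> (\<lambda>x. f x - fN x))\<^sup>2 + (\<Sum>\<alpha>\<in>A. (L\<^sup>2 + \<sigma>\<^sup>2) / real n)) / ?V"
      using V err_le by (intro divide_right_mono add_left_mono sum_mono) auto
    also have "\<dots> = Rp\<^sup>2"
      unfolding Rp_sq prod_M by (simp add: card_A add_divide_distrib ring_distribs mult.commute)
    finally show ?thesis .
  qed
  have sqrt_e: "integrable P (\<lambda>\<omega>. sqrt (e \<omega>))" "(\<integral>\<omega>. sqrt (e \<omega>) \<partial>P) \<le> Rp"
  proof -
    note I = W.integral_sqrt_le[OF e_int e_nonneg]
    show "integrable P (\<lambda>\<omega>. sqrt (e \<omega>))" by (fact I(1))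
    show "(\<integral>\<omega>. sqrt (e \<omega>) \<partial>P) \<le> Rp"
      using I(2) real_le_lsqrt[OF Rp_nonneg e_le] by linarith
  qed

  have main: "integrable P (\<lambda>\<omega>. (index f U - index (fhat \<omega>) U)\<^sup>2)
      \<and> integrable P (\<lambda>\<omega>. \<bar>index f U - index (fhat \<omega>) U\<bar>)
      \<and> (\<integral>\<omega>. (index f U - index (fhat \<omega>) U)\<^sup>2 \<partial>P) \<le> Rp\<^sup>2
      \<and> (\<integral>\<omega>. \<bar>index f U - index (fhat \<omega>) U\<bar> \<partial>P) \<le> Rp * (Rp + 2 * sqrt (index f U))"
    if U: "U \<subseteq> {1..d}" for U
  proof -
    obtain T where T: "T \<subseteq> Pow {1..d}" and share: "\<And>g G. in_L2 \<mu> g \<Longrightarrow> sobol_decomposition d M' g G \<Longrightarrow>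
        index g U = (if var \<mu> g = 0 then 1 / 2 ^ d else (\<Sum>W\<in>T. component_var d M' G W) / var \<mu> g)"
      using index_eq_share[OF index U] by blast
    define D where "D \<omega> = index f U - index (fhat \<omega>) U" for \<omega>
    have c: "(0::real) \<le> 1 / 2 ^ d" "1 / 2 ^ d \<le> (1::real)" by simp_all
    have S: "index f U = (\<Sum>W\<in>T. component_var d M' (moebius_component f) W) / ?V"
      using share[OF f F] V by simp
    have bounds: "0 \<le> index f U" "\<bar>D \<omega>\<bar> \<le> 1" "(D \<omega>)\<^sup>2 \<le> e \<omega>"
      "\<bar>D \<omega>\<bar> \<le> e \<omega> + 2 * sqrt (index f U) * sqrt (e \<omega>)" for \<omega>
      using share_perturbation[OF f fhat_L2[of \<omega>] F G[of \<omega>] T V c]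
      unfolding D_def share[OF fhat_L2[of \<omega>] G[of \<omega>]] S e_def by (auto simp only: abs_le_iff)
    have D_meas: "D \<in> borel_measurable P"
    proof -
      have "(\<lambda>\<omega>. index (fhat \<omega>) U) \<in> borel_measurable P"
        unfolding share[OF fhat_L2 G] unfolding fhat_eq
        by (rule share_expansion_measurable[OF A ch_meas])
      then show ?thesis unfolding D_def[abs_def] by simp
    qed
    have abs_int: "integrable P (\<lambda>\<omega>. \<bar>D \<omega>\<bar>)"
      by (rule W.integrable_const_bound[where B = 1]) (use D_meas bounds(2) in auto)
    have sq_int: "integrable P (\<lambda>\<omega>. (D \<omega>)\<^sup>2)"
      by (rule W.integrable_const_bound[where B = 1])
        (use D_meas bounds(2) in \<open>auto simp: abs_square_le_1\<close>)
    have "(\<integral>\<omega>. (D \<omega>)\<^sup>2 \<partial>P) \<le> (\<integral>\<omega>. e \<omega> \<partial>P)"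
      using sq_int e_int bounds(3) by (rule integral_mono)
    then have sq_le: "(\<integral>\<omega>. (D \<omega>)\<^sup>2 \<partial>P) \<le> Rp\<^sup>2" using e_le by linarith
    have "(\<integral>\<omega>. \<bar>D \<omega>\<bar> \<partial>P) \<le> (\<integral>\<omega>. e \<omega> + 2 * sqrt (index f U) * sqrt (e \<omega>) \<partial>P)"
      using abs_int bounds(4) e_int sqrt_e(1) by (intro integral_mono) auto
    also have "\<dots> = (\<integral>\<omega>. e \<omega> \<partial>P) + 2 * sqrt (index f U) * (\<integral>\<omega>. sqrt (e \<omega>) \<partial>P)"
      using e_int sqrt_e(1) by simp
    also have "\<dots> \<le> Rp\<^sup>2 + 2 * sqrt (index f U) * Rp"
      using e_le sqrt_e(2) bounds(1) by (intro add_mono mult_left_mono) auto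
    also have "\<dots> = Rp * (Rp + 2 * sqrt (index f U))" by (simp add: power2_eq_square algebra_simps)
    finally show ?thesis using abs_int sq_int sq_le unfolding D_def by blast
  qed
  have "(MAX U\<in>Pow {1..d}. \<integral>\<omega>. (index f U - index (fhat \<omega>) U)\<^sup>2 \<partial>P) \<le> Rp\<^sup>2"
    using main by (subst Max_le_iff) auto
  with main show ?thesis by blast
qed

end
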